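(* Let $0<n<N$. As operators on $\mathcal V_n$ the coefficients of the transfer matrices are given, for $1\le i,j\le N-1$, by $$E_i=\sum_{|w|=i}^{\circlearrowright}T_w\,\rho_n(\bar\pi_w),\qquad H_j=\sum_{|w|=j}^{\circlearrowleft}T_w\,\rho_n(\pi_w),$$ where the first sum runs over all clockwise ordered (cyclically increasing) elements $w\in\hat{\mathbb S}_N$ of length $i$ and the second over all anti-clockwise ordered (cyclically decreasing) elements $w\in\hat{\mathbb S}_N$ of length $j$.
   Context: Set $\Lambda=\mathbb Z[T_1,\dots,T_N]$, $t_i:=T_{N+1-i}$, $\tilde\Lambda=\mathbb Z[T_1^{\pm1},\dots,T_N^{\pm1}]$. $\mathcal V=\Lambda[q]\otimes V^{\otimes N}$ is the free $\Lambda[q]$-module with basis $v_{\varepsilon_1}\otimes\cdots\otimes v_{\varepsilon_N}$, $\varepsilon_j\in\{0,1\}$; $\mathcal V_n$ is the span of those with $\sum\varepsilon_j=n$, and $\tilde{\mathcal V}_n=\tilde\Lambda[q]\otimes_{\Lambda[q]}\mathcal V_n$. $\sigma^+v_0=v_1$, $\sigma^+v_1=0$, $\sigma^-v_1=v_0$, $\sigma^-v_0=0$; $\sigma_j^\pm$ acts on the $j$-th factor. With $$L_j(x)=\begin{pmatrix}1-xt_j\sigma_j^-\sigma_j^+ & x\sigma_j^+\\ \sigma_j^- & x\sigma_j^-\sigma_j^+\end{pmatrix},\qquad L'_j(x)=\begin{pmatrix}1+xt_j\sigma_j^+\sigma_j^- & x\sigma_j^+\\ \sigma_j^- & x\sigma_j^+\sigma_j^-\end{pmatrix}$$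 and $L_N\cdots L_1=\begin{pmatrix}A&B\\C&D\end{pmatrix}$, $L'_N\cdots L'_1=\begin{pmatrix}A'&B'\\C'&D'\end{pmatrix}$, the transfer matrices are $H(x)=A+qD=\sum_rH_rx^r$, $E(x)=A'+qD'=\sum_rE_rx^r$. The affine nil-Hecke algebra $\mathbb H_N$ has generators $\pi_1,\dots,\pi_N$ (indices mod $N$) with $\pi_i^2=-\pi_i$, $\pi_i\pi_{i+1}\pi_i=\pi_{i+1}\pi_i\pi_{i+1}$, and $\pi_i\pi_j=\pi_j\pi_i$ for non-adjacent $i,j$; put $\bar\pi_i=\pi_i+1$. Its representation $\rho$, restricted to $\tilde{\mathcal V}_n$ and denoted $\rho_n$, is $\rho(\pi_j)=t_j^{-1}\sigma_j^-\sigma_{j+1}^+-\sigma_j^-\sigma_j^+$ for $1\le j\le N-1$ and $\rho(\pi_N)=t_N^{-1}q\,\sigma_N^-\sigma_1^+-\sigma_N^-\sigma_N^+$; correspondingly $\rho(\bar\pi_j)=\rho(\pi_j)+1$. A word $w=j_1\cdots j_r$ with letters in $\{1,\dots,N\}$ is called clockwise (resp. anti-clockwise) ordered if each letter occurs at most once and, whenever both $j$ and $j+1$ (mod $N$) occur, $j+1$ occurs after (resp. before) $j$. An element of the affine symmetric group $\hat{\mathbb S}_N$ is called clockwise/anti-clockwise ordered if it has a reduced word with this property; words differing by exchanging commuting letters define the same element and are counted once. For a reduced word put $\pi_w=\pi_{j_1}\cdots\pi_{j_r}$, $\bar\pi_w=\bar\pi_{j_1}\cdots\bar\pi_{j_r}$,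 $T_w=T_{N+1-j_1}\cdots T_{N+1-j_r}=t_{j_1}\cdots t_{j_r}$. For $N=2$ only words of length one occur and the formulas for $\rho(\pi_j),\rho(\bar\pi_j)$ are used directly. *)

theory Defs
  imports
    "HOL-Library.Poly_Mapping"
    "HOL-Library.Function_Algebras"
    "HOL-Library.FuncSet"
    "HOL-Computational_Algebra.Polynomial"
    "HOL-Algebra.QuotRing"
begin

section \<open>Coefficient rings\<close>

text \<open>
  The monoid ring of finitely supported maps from nat to int (exponent vectors) is the ring of
  Laurent polynomials in the variables \<open>T\<^sub>0, T\<^sub>1, \<dots>\<close>; the sets below cut out those that involve
  only \<open>T\<^sub>1, \<dots>, T\<^sub>N\<close>.
\<close>

type_synonym laurent = "(nat \<Rightarrow>\<^sub>0 int) \<Rightarrow>\<^sub>0 int"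

definition T :: "nat \<Rightarrow> laurent" where
  "T i = Poly_Mapping.single (Poly_Mapping.single i 1) 1"

definition Tinv :: "nat \<Rightarrow> laurent" where
  "Tinv i = Poly_Mapping.single (Poly_Mapping.single i (- 1)) 1"

lemma T_Tinv: "T i * Tinv i = 1"
  by (simp add: T_def Tinv_def mult_single flip: single_add)

definition t :: "nat \<Rightarrow> nat \<Rightarrow> laurent" where
  "t N j = T (N + 1 - j)"

definition tinv :: "nat \<Rightarrow> nat \<Rightarrow> laurent" where
  "tinv N j = Tinv (N + 1 - j)"

definition Lambda_tilde :: "nat \<Rightarrow> laurent set" where
  "Lambda_tilde N = {p. \<forall>m \<in> Poly_Mapping.keys p. Poly_Mapping.keys m \<subseteq> {1..N}}"

definition Lambda :: "nat \<Rightarrow> laurent set" where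
  "Lambda N = {p \<in> Lambda_tilde N. \<forall>m \<in> Poly_Mapping.keys p. \<forall>i. Poly_Mapping.lookup m i \<ge> 0}"

definition adjoin_q :: "laurent set \<Rightarrow> laurent poly set" where
  "adjoin_q R = {p. \<forall>k. coeff p k \<in> R}"

definition qvar :: "laurent poly" where
  "qvar = [:0, 1:]"


section \<open>The space of states\<close>

text \<open>
  A vector is given by its coordinates with respect to the basis
  \<open>v\<^sub>\<epsilon> = v\<^bsub>\<epsilon>(1)\<^esub> \<otimes> \<dots> \<otimes> v\<^bsub>\<epsilon>(N)\<^esub>\<close>, indexed by the maps \<open>\<epsilon>\<close> from \<open>{1..N}\<close> to \<open>{0, 1}\<close>.
  Addition and subtraction of vectors and of operators are the pointwise ones.
\<close>

type_synonym 'a vec = "(nat \<Rightarrow> nat) \<Rightarrow> 'a"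
type_synonym 'a opr = "'a vec \<Rightarrow> 'a vec"

definition basis_vec :: "(nat \<Rightarrow> nat) \<Rightarrow> 'a::zero_neq_one vec" where
  "basis_vec \<epsilon> = (\<lambda>\<eta>. if \<eta> = \<epsilon> then 1 else 0)"

definition configs :: "nat \<Rightarrow> nat \<Rightarrow> (nat \<Rightarrow> nat) set" where
  "configs N n = {\<epsilon> \<in> {1..N} \<rightarrow>\<^sub>E {0, 1}. (\<Sum>j = 1..N. \<epsilon> j) = n}"

definition weight_space :: "'a::zero set \<Rightarrow> nat \<Rightarrow> nat \<Rightarrow> 'a vec set" where
  "weight_space R N n = {\<psi>. (\<forall>\<epsilon>. \<psi> \<epsilon> \<in> R) \<and> (\<forall>\<epsilon>. \<epsilon> \<notin> configs N n \<longrightarrow> \<psi> \<epsilon> = 0)}"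

definition V :: "nat \<Rightarrow> nat \<Rightarrow> laurent poly vec set" where
  "V N n = weight_space (adjoin_q (Lambda N)) N n"

definition V_tilde :: "nat \<Rightarrow> nat \<Rightarrow> laurent poly vec set" where
  "V_tilde N n = weight_space (adjoin_q (Lambda_tilde N)) N n"

definition smul :: "'a::times \<Rightarrow> 'a opr" where
  "smul c \<psi> = (\<lambda>\<epsilon>. c * \<psi> \<epsilon>)"

definition sigma_plus :: "nat \<Rightarrow> 'a::zero opr" where
  "sigma_plus j \<psi> = (\<lambda>\<epsilon>. if \<epsilon> j = 1 then \<psi> (\<epsilon>(j := 0)) else 0)"

definition sigma_minus :: "nat \<Rightarrow> 'a::zero opr" where
  "sigma_minus j \<psi> = (\<lambda>\<epsilon>. if \<epsilon> j = 0 then \<psi> (\<epsilon>(j := 1)) else 0)"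

lemma sigma_plus_basis_vec:
  "\<epsilon> j = 0 \<Longrightarrow> sigma_plus j (basis_vec \<epsilon>) = basis_vec (\<epsilon>(j := 1))"
  "\<epsilon> j = 1 \<Longrightarrow> sigma_plus j (basis_vec \<epsilon>) = 0"
  by (auto simp: sigma_plus_def basis_vec_def fun_eq_iff split: if_splits)

lemma sigma_minus_basis_vec:
  "\<epsilon> j = 1 \<Longrightarrow> sigma_minus j (basis_vec \<epsilon>) = basis_vec (\<epsilon>(j := 0))"
  "\<epsilon> j = 0 \<Longrightarrow> sigma_minus j (basis_vec \<epsilon>) = 0"
  by (auto simp: sigma_minus_def basis_vec_def fun_eq_iff split: if_splits)


section \<open>Transfer matrices\<close>

text \<open>The tuple \<open>(a, b, c, d)\<close> is the matrix with rows \<open>(a, b)\<close> and \<open>(c, d)\<close>.\<close>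

type_synonym 'a opr_mat = "'a opr \<times> 'a opr \<times> 'a opr \<times> 'a opr"

fun opr_mat_mult :: "'a::comm_ring_1 opr_mat \<Rightarrow> 'a opr_mat \<Rightarrow> 'a opr_mat" where
  "opr_mat_mult (a, b, c, d) (a', b', c', d') =
     ((a \<circ> a') + (b \<circ> c'), (a \<circ> b') + (b \<circ> d'), (c \<circ> a') + (d \<circ> c'), (c \<circ> b') + (d \<circ> d'))"

definition Lax_H :: "'a::comm_ring_1 \<Rightarrow> (nat \<Rightarrow> 'a) \<Rightarrow> nat \<Rightarrow> 'a opr_mat" where
  "Lax_H x s j =
     (id - (smul (x * s j) \<circ> sigma_minus j \<circ> sigma_plus j), smul x \<circ> sigma_plus j,
      sigma_minus j, smul x \<circ> sigma_minus j \<circ> sigma_plus j)"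

definition Lax_E :: "'a::comm_ring_1 \<Rightarrow> (nat \<Rightarrow> 'a) \<Rightarrow> nat \<Rightarrow> 'a opr_mat" where
  "Lax_E x s j =
     (id + (smul (x * s j) \<circ> sigma_plus j \<circ> sigma_minus j), smul x \<circ> sigma_plus j,
      sigma_minus j, smul x \<circ> sigma_plus j \<circ> sigma_minus j)"

primrec monodromy :: "(nat \<Rightarrow> 'a::comm_ring_1 opr_mat) \<Rightarrow> nat \<Rightarrow> 'a opr_mat" where
  "monodromy L 0 = (id, 0, 0, id)"
| "monodromy L (Suc k) = opr_mat_mult (L (Suc k)) (monodromy L k)"

definition twisted_trace :: "'a::comm_ring_1 \<Rightarrow> 'a opr_mat \<Rightarrow> 'a opr" where
  "twisted_trace q = (\<lambda>(A, B, C, D). A + (smul q \<circ> D))"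

text \<open>The outer polynomial variable is the spectral parameter \<open>x\<close>, the inner one is \<open>q\<close>.\<close>

definition H_transfer :: "nat \<Rightarrow> laurent poly poly opr" where
  "H_transfer N = twisted_trace [:qvar:] (monodromy (Lax_H [:0, 1:] (\<lambda>j. [:[:t N j:]:])) N)"

definition E_transfer :: "nat \<Rightarrow> laurent poly poly opr" where
  "E_transfer N = twisted_trace [:qvar:] (monodromy (Lax_E [:0, 1:] (\<lambda>j. [:[:t N j:]:])) N)"

definition opr_coeff :: "nat \<Rightarrow> 'a::zero poly opr \<Rightarrow> 'a opr" where
  "opr_coeff r F \<psi> = (\<lambda>\<epsilon>. coeff (F (\<lambda>\<eta>. [:\<psi> \<eta>:]) \<epsilon>) r)"

definition H :: "nat \<Rightarrow> nat \<Rightarrow> laurent poly opr" where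
  "H N r = opr_coeff r (H_transfer N)"

definition E :: "nat \<Rightarrow> nat \<Rightarrow> laurent poly opr" where
  "E N r = opr_coeff r (E_transfer N)"


section \<open>The affine nil-Hecke algebra\<close>

definition nxt :: "nat \<Rightarrow> nat \<Rightarrow> nat" where
  "nxt N j = j mod N + 1"

text \<open>Words under concatenation, so that \<open>word \<Rightarrow>\<^sub>0 int\<close> is a free associative ring.\<close>

datatype word = Word (letters: "nat list")

instantiation word :: monoid_add
begin

definition "0 = Word []"
definition "u + v = Word (letters u @ letters v)"

instance
  by standard (simp_all add: zero_word_def plus_word_def)

end

definition free_ring :: "nat \<Rightarrow> (word \<Rightarrow>\<^sub>0 int) ring" where
  "free_ring N =
     \<lparr>carrier = {f. \<forall>u \<in> Poly_Mapping.keys f. set (letters u) \<subseteq> {1..N}},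
      mult = (*), one = 1, zero = 0, add = (+)\<rparr>"

definition gen :: "nat \<Rightarrow> (word \<Rightarrow>\<^sub>0 int)" where
  "gen j = Poly_Mapping.single (Word [j]) 1"

text \<open>
  For \<open>N = 2\<close> the two generators satisfy no braid relation, as in the infinite dihedral group.
\<close>

definition nil_Hecke_relators :: "nat \<Rightarrow> (word \<Rightarrow>\<^sub>0 int) set" where
  "nil_Hecke_relators N =
     {gen i * gen i + gen i | i. i \<in> {1..N}} \<union>
     {gen i * gen (nxt N i) * gen i - gen (nxt N i) * gen i * gen (nxt N i) | i. i \<in> {1..N} \<and> N \<ge> 3} \<union>
     {gen i * gen j - gen j * gen i | i j. i \<in> {1..N} \<and> j \<in> {1..N} \<and> j \<noteq> nxt N i \<and> i \<noteq> nxt N j}"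

definition nil_Hecke_ideal :: "nat \<Rightarrow> (word \<Rightarrow>\<^sub>0 int) set" where
  "nil_Hecke_ideal N = Idl\<^bsub>free_ring N\<^esub> (nil_Hecke_relators N)"

definition nil_Hecke :: "nat \<Rightarrow> (word \<Rightarrow>\<^sub>0 int) set ring" where
  "nil_Hecke N = free_ring N Quot nil_Hecke_ideal N"

definition nH_pi :: "nat \<Rightarrow> nat \<Rightarrow> (word \<Rightarrow>\<^sub>0 int) set" where
  "nH_pi N j = nil_Hecke_ideal N +>\<^bsub>free_ring N\<^esub> gen j"

definition nH_pibar :: "nat \<Rightarrow> nat \<Rightarrow> (word \<Rightarrow>\<^sub>0 int) set" where
  "nH_pibar N j = nH_pi N j \<oplus>\<^bsub>nil_Hecke N\<^esub> \<one>\<^bsub>nil_Hecke N\<^esub>"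

definition nH_prod :: "nat \<Rightarrow> (word \<Rightarrow>\<^sub>0 int) set list \<Rightarrow> (word \<Rightarrow>\<^sub>0 int) set" where
  "nH_prod N hs = foldr (\<lambda>a b. a \<otimes>\<^bsub>nil_Hecke N\<^esub> b) hs \<one>\<^bsub>nil_Hecke N\<^esub>"


section \<open>The representation\<close>

definition rho_gen :: "nat \<Rightarrow> nat \<Rightarrow> laurent poly opr" where
  "rho_gen N j =
     (smul ([:tinv N j:] * (if j = N then qvar else 1)) \<circ> sigma_minus j \<circ> sigma_plus (nxt N j))
     - (sigma_minus j \<circ> sigma_plus j)"

definition rho_free :: "nat \<Rightarrow> (word \<Rightarrow>\<^sub>0 int) \<Rightarrow> laurent poly opr" where
  "rho_free N f =
     (\<Sum>u \<in> Poly_Mapping.keys f.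
        smul (of_int (Poly_Mapping.lookup f u)) \<circ> foldr (\<lambda>j F. rho_gen N j \<circ> F) (letters u) id)"

text \<open>The map induced on the quotient: all representatives of a residue class act alike.\<close>

definition rho :: "nat \<Rightarrow> (word \<Rightarrow>\<^sub>0 int) set \<Rightarrow> laurent poly opr" where
  "rho N h = the_elem (rho_free N ` h)"

definition rho_n :: "nat \<Rightarrow> nat \<Rightarrow> (word \<Rightarrow>\<^sub>0 int) set \<Rightarrow> laurent poly opr" where
  "rho_n N n h = restrict (rho N h) (V_tilde N n)"


section \<open>The affine symmetric group and cyclically ordered elements\<close>

definition affine_Sym :: "nat \<Rightarrow> (int \<Rightarrow> int) set" where
  "affine_Sym N = {f. bij f \<and> (\<forall>i. f (i + int N) = f i + int N) \<and>
     (\<Sum>i = 1..int N. f i) = (\<Sum>i = 1..int N. i)}"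

definition simple_refl :: "nat \<Rightarrow> nat \<Rightarrow> int \<Rightarrow> int" where
  "simple_refl N j i =
     (if i mod int N = int j mod int N then i + 1
      else if i mod int N = (int j + 1) mod int N then i - 1
      else i)"

definition word_perm :: "nat \<Rightarrow> nat list \<Rightarrow> int \<Rightarrow> int" where
  "word_perm N js = foldr (\<lambda>j f. simple_refl N j \<circ> f) js id"

definition is_word_of :: "nat \<Rightarrow> nat list \<Rightarrow> (int \<Rightarrow> int) \<Rightarrow> bool" where
  "is_word_of N js w \<longleftrightarrow> set js \<subseteq> {1..N} \<and> word_perm N js = w"

definition aff_length :: "nat \<Rightarrow> (int \<Rightarrow> int) \<Rightarrow> nat" where
  "aff_length N w = (LEAST r. \<exists>js. is_word_of N js w \<and> length js = r)"

definition is_reduced_word_of :: "nat \<Rightarrow> nat list \<Rightarrow> (int \<Rightarrow> int) \<Rightarrow> bool" where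
  "is_reduced_word_of N js w \<longleftrightarrow> is_word_of N js w \<and> length js = aff_length N w"

definition clockwise :: "nat \<Rightarrow> nat list \<Rightarrow> bool" where
  "clockwise N js \<longleftrightarrow> distinct js \<and>
     (\<forall>a < length js. \<forall>b < length js. js ! b = nxt N (js ! a) \<longrightarrow> a < b)"

definition anticlockwise :: "nat \<Rightarrow> nat list \<Rightarrow> bool" where
  "anticlockwise N js \<longleftrightarrow> distinct js \<and>
     (\<forall>a < length js. \<forall>b < length js. js ! b = nxt N (js ! a) \<longrightarrow> b < a)"

definition clockwise_elements :: "nat \<Rightarrow> nat \<Rightarrow> (int \<Rightarrow> int) set" where
  "clockwise_elements N r = {w \<in> affine_Sym N. aff_length N w = r \<and>
     (\<exists>js. is_reduced_word_of N js w \<and> clockwise N js)}"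

definition anticlockwise_elements :: "nat \<Rightarrow> nat \<Rightarrow> (int \<Rightarrow> int) set" where
  "anticlockwise_elements N r = {w \<in> affine_Sym N. aff_length N w = r \<and>
     (\<exists>js. is_reduced_word_of N js w \<and> anticlockwise N js)}"

lemma finite_elements_of_length:
  "finite {w. aff_length N w = r \<and> (\<exists>js. is_reduced_word_of N js w)}"
proof (rule finite_subset)
  show "{w. aff_length N w = r \<and> (\<exists>js. is_reduced_word_of N js w)}
      \<subseteq> word_perm N ` {js. set js \<subseteq> {1..N} \<and> length js = r}"
    by (auto simp: is_reduced_word_of_def is_word_of_def)
qed (simp add: finite_lists_length_eq)

lemma finite_clockwise_elements: "finite (clockwise_elements N r)"
  by (rule finite_subset[OF _ finite_elements_of_length[of N r]])
     (auto simp: clockwise_elements_def)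

lemma finite_anticlockwise_elements: "finite (anticlockwise_elements N r)"
  by (rule finite_subset[OF _ finite_elements_of_length[of N r]])
     (auto simp: anticlockwise_elements_def)

text \<open>
  Any two reduced words of \<open>w\<close> are related by commutation and braid moves, which the products
  \<open>\<pi>\<^sub>w\<close> and \<open>\<pi>\<bar>\<^sub>w\<close> respect; so does \<open>T\<^sub>w\<close> for the elements with pairwise distinct letters.
\<close>

definition reduced_word :: "nat \<Rightarrow> (int \<Rightarrow> int) \<Rightarrow> nat list" where
  "reduced_word N w = (SOME js. is_reduced_word_of N js w)"

definition pi_elt :: "nat \<Rightarrow> (int \<Rightarrow> int) \<Rightarrow> (word \<Rightarrow>\<^sub>0 int) set" where
  "pi_elt N w = nH_prod N (map (nH_pi N) (reduced_word N w))"

definition pibar_elt :: "nat \<Rightarrow> (int \<Rightarrow> int) \<Rightarrow> (word \<Rightarrow>\<^sub>0 int) set" where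
  "pibar_elt N w = nH_prod N (map (nH_pibar N) (reduced_word N w))"

definition T_elt :: "nat \<Rightarrow> (int \<Rightarrow> int) \<Rightarrow> laurent" where
  "T_elt N w = prod_list (map (\<lambda>j. T (N + 1 - j)) (reduced_word N w))"

end

theory Submission
  imports Defs
begin

text \<open>
  The matrix entries of the transfer matrices are sums over the states \<open>a\<^sub>0, \<dots>, a\<^sub>N\<close> of the
  auxiliary space, where \<open>a\<^sub>j = 1\<close> says that a particle passes from site \<open>j\<close> to site \<open>j + 1\<close>.
  For \<open>E\<close> such a term also arises by expanding a product of local operators
  \<open>p\<^sub>j = q\<^sup>\<delta> \<sigma>\<^sup>-\<^sub>j \<sigma>\<^sup>+\<^sub>j\<^sub>+\<^sub>1 + d\<^sub>j\<close> with \<open>d\<^sub>j = t\<^sub>j \<sigma>\<^sup>+\<^sub>j \<sigma>\<^sup>-\<^sub>j\<close> (\<open>\<delta> = 1\<close> for \<open>j = N\<close> and \<open>\<delta> = 0\<close> otherwise),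
  and on vectors supported on \<open>0\<close>-\<open>1\<close> configurations \<open>p\<^sub>j\<close> is \<open>t\<^sub>j\<close> times the action of \<open>\<pi>\<bar>\<^sub>j\<close>.
  For \<open>H\<close> the same holds with \<open>d\<^sub>j = - t\<^sub>j \<sigma>\<^sup>-\<^sub>j \<sigma>\<^sup>+\<^sub>j\<close>, where \<open>p\<^sub>j\<close> is \<open>t\<^sub>j\<close> times the action of \<open>\<pi>\<^sub>j\<close>.
  So both formulas say that the coefficient of \<open>x\<^sup>r\<close> in the transfer matrix is the sum, over the subsets of
  the circle \<open>{1..N}\<close> with \<open>r < N\<close> elements, of the product of the \<open>p\<^sub>j\<close>, in cyclic order for \<open>E\<close> and in
  the reverse order for \<open>H\<close>.

  The algebra behind this is short (locale \<open>site_ring\<close>). Let \<open>P\<^sub>k = (1 + x p\<^sub>1) \<cdots> (1 + x p\<^sub>k)\<close>. The relation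
  \<open>\<sigma>\<^sup>+\<^sub>j d\<^sub>j = 0\<close> makes the recursion \<open>L\<^sub>k\<^sub>+\<^sub>1 \<cdots> L\<^sub>1 = L\<^sub>k\<^sub>+\<^sub>1 (L\<^sub>k \<cdots> L\<^sub>1)\<close> solvable in closed form:
  the first column of the monodromy matrix of \<open>k + 1\<close> sites is
  \<open>(P\<^sub>k (1 + x d\<^sub>k\<^sub>+\<^sub>1), P\<^sub>k \<sigma>\<^sup>-\<^sub>k\<^sub>+\<^sub>1)\<close> and the second column is obtained from the first by
  multiplication with \<open>x \<sigma>\<^sup>+\<^sub>1\<close> from the left.
  The twisted trace is then expanded by the largest index \<open>m\<close> that is missing in a product. In the two terms
  containing \<open>d\<^sub>N\<close> and \<open>q \<sigma>\<^sup>+\<^sub>1 \<sigma>\<^sup>-\<^sub>N\<close> the factors far from the gap commute, the terms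
  combine to \<open>p\<^sub>N\<close>, and the result is
  \<open>\<Sum>\<^sub>m x\<^sup>N\<^sup>-\<^sup>m p\<^sub>m\<^sub>+\<^sub>1 \<cdots> p\<^sub>N P\<^sub>m\<^sub>-\<^sub>1\<close> up to a multiple of \<open>x\<^sup>N\<close> (lemma \<open>trace_largest_gap\<close>).
  The two transfer matrices are mirror images: the computation for \<open>H\<close> is the one for \<open>E\<close> in the
  opposite ring.

  On the side of the affine symmetric group, a word with distinct letters is reduced, and its permutation
  determines the letters and the order of cyclically adjacent ones. Both facts come from looking at which
  integers are carried across a given position (lemmas \<open>distinct_word_crosses\<close>,
  \<open>no_descent_if_nxt_left\<close> and \<open>descent_if_nxt_right\<close>). Hence every reduced word of a clockwise element is
  clockwise, and the clockwise elements of length \<open>r < N\<close> correspond to the subsets of size \<open>r\<close>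
  (lemma \<open>clockwise_elements_bij\<close>). Anticlockwise elements are their inverses.

  Finally, the value of the representation on a residue class can be computed from any representative because
  the operators satisfy the defining relations (lemma \<open>free_op_nil_Hecke_ideal\<close>).
\<close>


section \<open>Words with distinct letters in the affine symmetric group\<close>

text \<open>
  A simple reflection exchanges neighbours, so it carries integers across the position between \<open>p\<close> and
  \<open>p + 1\<close> only if it exchanges exactly these two.
\<close>

lemma simple_refl_le_iff:
  assumes "p mod int N \<noteq> int j mod int N"
  shows "simple_refl N j k \<le> p \<longleftrightarrow> k \<le> p"
proof -
  have "(p + 1) mod int N \<noteq> (int j + 1) mod int N"
    using assms by (simp add: mod_eq_dvd_iff)
  then show ?thesis
    using assms by (cases "k = p"; cases "k = p + 1") (auto simp: simple_refl_def)
qed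

lemma simple_refl_involution:
  assumes "2 \<le> N"
  shows "simple_refl N j (simple_refl N j i) = i"
proof -
  have shift: "(a + 1) mod int N \<noteq> a mod int N" for a
  proof
    assume "(a + 1) mod int N = a mod int N"
    then have "int N dvd a + 1 - a"
      using mod_eq_dvd_iff by blast
    then show False
      using assms by (auto simp: zdvd1_eq)
  qed
  have *: "(a + 1) mod int N = (b + 1) mod int N \<longleftrightarrow> a mod int N = b mod int N" for a b
    by (simp add: mod_eq_dvd_iff)
  have "(i - 1) mod int N = int j mod int N \<longleftrightarrow> i mod int N = (int j + 1) mod int N"
    using *[of "i - 1" "int j"] by simp
  then show ?thesis
    using shift[of i] shift[of "int j"] *[of i "int j"] by (auto simp: simple_refl_def)
qed

lemma letters_mod_eq_iff:
  assumes "i \<in> {1..N}" "j \<in> {1..N}"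
  shows "int i mod int N = int j mod int N \<longleftrightarrow> i = j"
proof -
  have "i mod N = j mod N \<longleftrightarrow> i = j"
    using assms by (cases "i = N"; cases "j = N") auto
  then show ?thesis
    by (metis of_nat_eq_iff of_nat_mod)
qed

lemma nxt_letter: "1 \<le> N \<Longrightarrow> nxt N a \<in> {1..N}"
  by (auto simp: nxt_def Suc_le_eq)

lemma nxt_mod: "int (nxt N a) mod int N = (int a + 1) mod int N"
  by (simp add: nxt_def zmod_int mod_simps add.commute)

lemma simple_refl_comm:
  assumes "2 \<le> N" "i \<in> {1..N}" "j \<in> {1..N}" "i \<noteq> nxt N j" "j \<noteq> nxt N i"
  shows "simple_refl N i \<circ> simple_refl N j = simple_refl N j \<circ> simple_refl N i"
proof (cases "i = j")
  case False
  define moved where "moved a k \<longleftrightarrow> k mod int N \<in> {int a mod int N, int (nxt N a) mod int N}" for a k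
  have fixed: "simple_refl N a k = k" if "\<not> moved a k" for a k
    using that by (auto simp: moved_def simple_refl_def nxt_mod)
  have stays: "moved a (simple_refl N a k)" if "moved a k" for a k
    using that fixed[of a "simple_refl N a k"] simple_refl_involution[OF assms(1), of a k]
    by metis
  have "nxt N i \<noteq> nxt N j"
  proof
    assume "nxt N i = nxt N j"
    then have "int i mod int N = int j mod int N"
      using nxt_mod[of N i] nxt_mod[of N j] by (metis add_diff_cancel_right' mod_diff_left_eq)
    then show False
      using False letters_mod_eq_iff assms(2,3) by blast
  qed
  then have disjoint: "\<not> (moved i k \<and> moved j k)" for k
    unfolding moved_def
    using assms False letters_mod_eq_iff[of _ N] nxt_letter[of N] by force
  show ?thesis
  proof
    fix k
    show "(simple_refl N i \<circ> simple_refl N j) k = (simple_refl N j \<circ> simple_refl N i) k"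
      using fixed stays disjoint by (metis comp_apply)
  qed
qed simp

lemma word_perm_Nil [simp]: "word_perm N [] = id"
  and word_perm_Cons [simp]: "word_perm N (j # js) = simple_refl N j \<circ> word_perm N js"
  by (simp_all add: word_perm_def)

lemma word_perm_append [simp]: "word_perm N (js @ ks) = word_perm N js \<circ> word_perm N ks"
  by (induction js) auto

lemma word_perm_rev:
  assumes "2 \<le> N"
  shows "word_perm N js \<circ> word_perm N (rev js) = id"
  by (induction js rule: rev_induct)
     (simp_all add: fun_eq_iff simple_refl_involution[OF assms])

lemma bij_word_perm: "2 \<le> N \<Longrightarrow> bij (word_perm N js)"
  using word_perm_rev[of N js] word_perm_rev[of N "rev js"] by (metis o_bij rev_rev_ident)

lemma inv_word_perm: "2 \<le> N \<Longrightarrow> inv_into UNIV (word_perm N js) = word_perm N (rev js)"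
  using word_perm_rev[of N js] word_perm_rev[of N "rev js"] by (metis inv_unique_comp rev_rev_ident)

lemma word_perm_in_affine_Sym:
  assumes "2 \<le> N" "set js \<subseteq> {1..N}"
  shows "word_perm N js \<in> affine_Sym N"
  using assms(2)
proof (induction js rule: rev_induct)
  case Nil
  then show ?case by (simp add: affine_Sym_def bij_betw_def)
next
  case (snoc j js)
  let ?f = "word_perm N js" and ?s = "simple_refl N j"
  have IH: "?f (i + int N) = ?f i + int N" "sum ?f {1..int N} = \<Sum>{1..int N}" for i
    using snoc by (auto simp: affine_Sym_def)
  have j: "1 \<le> j" "j \<le> N" using snoc by auto
  have s: "?s i = (if i = int j then i + 1 else if i = int (nxt N j) then i - 1 else i)"
    if i: "1 \<le> i" "i \<le> int N" for i
  proof -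
    have "i mod int N = int a mod int N \<longleftrightarrow> i = int a" if "a \<in> {1..N}" for a
      using letters_mod_eq_iff[of "nat i" N a] that i by (simp add: le_nat_iff nat_le_iff nat_eq_iff)
    from this[of j] this[OF nxt_letter, of j] show ?thesis
      using j assms(1) by (simp add: simple_refl_def nxt_mod)
  qed
  have "(\<Sum>i = 1..int N. ?f (?s i)) = (\<Sum>i = 1..int N. ?f i)"
  proof (cases "j = N")
    case False
    then have "nxt N j = j + 1"
      using j by (simp add: nxt_def)
    then have "?s i \<in> {1..int N}" if "i \<in> {1..int N}" for i
      using that j False s[of i] by (simp split: if_splits)
    then show ?thesis
      by (intro sum.reindex_bij_witness[of _ ?s ?s]) (auto simp: simple_refl_involution[OF assms(1)])
  next
    case True
    have nxt: "nxt N N = 1"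
      by (simp add: nxt_def)
    have split: "{1..int N} = insert 1 (insert (int N) {2..int N - 1})"
      using assms(1) by auto
    have "(\<Sum>i = 2..int N - 1. ?f (?s i)) = (\<Sum>i = 2..int N - 1. ?f i)"
      using s nxt by (intro sum.cong) (simp_all add: True)
    then show ?thesis
      unfolding split using assms(1) s[of 1] s[of "int N"] IH(1)[of 0] IH(1)[of 1]
      by (simp add: nxt True add.commute)
  qed
  moreover have "?s (i + int N) = ?s i + int N" for i
    by (simp add: simple_refl_def)
  ultimately show ?case
    using IH bij_word_perm[OF assms(1), of "js @ [j]"] by (simp add: affine_Sym_def comp_def)
qed

text \<open>
  The letter \<open>b\<close> is the only one that can carry an integer across the positions congruent to \<open>b\<close>; a word
  without it preserves the set of integers up to such a position and its complement.
\<close>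

lemma word_perm_le_iff:
  assumes "b \<in> {1..N}" "p mod int N = int b mod int N" "b \<notin> set js" "set js \<subseteq> {1..N}"
  shows "word_perm N js k \<le> p \<longleftrightarrow> k \<le> p"
  using assms(3,4)
proof (induction js)
  case (Cons j js)
  then have "p mod int N \<noteq> int j mod int N"
    using assms(1,2) letters_mod_eq_iff[of b N j] by simp
  then show ?case
    using Cons by (simp add: simple_refl_le_iff)
qed simp

text \<open>
  The letter \<open>j\<close> occurs once, so some integer is moved from \<open>j\<close> to \<open>j + 1\<close> at this moment. The other letters
  cannot have brought it across this position before, and cannot bring it back.
\<close>

lemma distinct_word_crosses:
  assumes "2 \<le> N" "distinct js" "set js \<subseteq> {1..N}" "j \<in> set js"
  shows "\<exists>k \<le> int j. int j < word_perm N js k"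
proof -
  obtain us vs where js: "js = us @ j # vs"
    using assms(4) by (meson split_list)
  \<comment> \<open>Neither part of the word besides \<open>j\<close> carries anything across position \<open>j\<close>.\<close>
  have barrier: "word_perm N ks k \<le> int j \<longleftrightarrow> k \<le> int j" if "ks = us \<or> ks = vs" for ks k
    using that assms(2-4) js by (intro word_perm_le_iff[of j]) auto
  obtain k where k: "word_perm N vs k = int j"
    using bij_word_perm[OF assms(1)] by (metis bij_pointE)
  have "k \<le> int j"
    using barrier[of vs k] k by simp
  moreover have "\<not> word_perm N us (int j + 1) \<le> int j"
    using barrier[of us] by simp
  ultimately show ?thesis
    using k js by (intro exI[of _ k]) (simp add: simple_refl_def)
qed

text \<open>
  Crossing at position \<open>j\<close> is a property of the permutation, so each letter of a word with distinct letters
  occurs in every word of the same permutation. This yields reducedness without a formula for the length.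
\<close>

lemma distinct_word_letters_subset:
  assumes "2 \<le> N" "distinct js" "set js \<subseteq> {1..N}" "set ks \<subseteq> {1..N}"
    "word_perm N js = word_perm N ks"
  shows "set js \<subseteq> set ks"
proof
  fix j assume j: "j \<in> set js"
  show "j \<in> set ks"
  proof (rule ccontr)
    assume "j \<notin> set ks"
    then have "word_perm N ks k \<le> int j \<longleftrightarrow> k \<le> int j" for k
      using assms(3,4) j by (intro word_perm_le_iff[of j]) auto
    then show False
      using distinct_word_crosses[OF assms(1-3) j] assms(5) by (metis not_le)
  qed
qed

lemma distinct_word_reduced:
  assumes "2 \<le> N" "distinct js" "set js \<subseteq> {1..N}"
  shows "is_reduced_word_of N js (word_perm N js)"
proof -
  have "aff_length N (word_perm N js) = length js"
    unfolding aff_length_def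
  proof (rule Least_equality)
    show "\<exists>ks. is_word_of N ks (word_perm N js) \<and> length ks = length js"
      using assms(3) by (auto simp: is_word_of_def)
    fix r assume "\<exists>ks. is_word_of N ks (word_perm N js) \<and> length ks = r"
    then obtain ks where "set ks \<subseteq> {1..N}" "word_perm N ks = word_perm N js" "length ks = r"
      by (auto simp: is_word_of_def)
    then show "length js \<le> r"
      using distinct_word_letters_subset[OF assms, of ks] assms(2)
      by (metis List.finite_set card_length card_mono distinct_card le_trans)
  qed
  then show ?thesis
    using assms(3) by (simp add: is_reduced_word_of_def is_word_of_def)
qed

lemma reduced_word_of_distinct_word:
  assumes "2 \<le> N" "distinct js" "set js \<subseteq> {1..N}"
    and ks: "is_reduced_word_of N ks (word_perm N js)"
  shows "distinct ks \<and> set ks = set js"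
proof -
  have len: "length ks = length js"
    using distinct_word_reduced[OF assms(1-3)] ks by (simp add: is_reduced_word_of_def)
  have sub: "set js \<subseteq> set ks"
    using ks distinct_word_letters_subset[OF assms(1-3)]
    by (simp add: is_reduced_word_of_def is_word_of_def)
  have "card (set js) = length ks"
    using len assms(2) by (simp add: distinct_card)
  then have "card (set ks) = length ks"
    using card_mono[OF _ sub] card_length[of ks] by simp
  then show ?thesis
    using len \<open>card (set js) = length ks\<close> card_subset_eq[OF _ sub] card_distinct[of ks] by auto
qed


section \<open>Cyclically ordered words\<close>

lemma nxt_neq:
  assumes "2 \<le> N"
  shows "nxt N a \<noteq> a"
proof (cases "a \<le> N")
  case False
  then show ?thesis
    using nxt_letter[of N a] assms by simp
qed (use assms in \<open>cases "a = N"; simp add: nxt_def\<close>)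

text \<open>
  This turns the conditions on pairs of positions in \<^const>\<open>clockwise\<close> and \<^const>\<open>anticlockwise\<close> into the
  form of \<^const>\<open>sorted_wrt\<close>, which is stable under deletion and concatenation.
\<close>

lemma all_pairs_ordered_iff:
  fixes n :: nat
  assumes "\<And>i. \<not> P i i"
  shows "(\<forall>a<n. \<forall>b<n. P b a \<longrightarrow> a < b) \<longleftrightarrow> (\<forall>i j. i < j \<longrightarrow> j < n \<longrightarrow> \<not> P i j)"
proof (intro iffI allI impI notI)
  fix a b assume "\<forall>i j. i < j \<longrightarrow> j < n \<longrightarrow> \<not> P i j" "a < n" "b < n" "P b a"
  then show "a < b"
    using assms by (cases a b rule: linorder_cases) auto
next
  fix i j assume "\<forall>a<n. \<forall>b<n. P b a \<longrightarrow> a < b" "i < j" "j < n" "P i j"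
  then have "j < i" by auto
  then show False using \<open>i < j\<close> by simp
qed

lemma clockwise_iff:
  assumes "2 \<le> N"
  shows "clockwise N js \<longleftrightarrow> distinct js \<and> sorted_wrt (\<lambda>b a. b \<noteq> nxt N a) js"
  unfolding clockwise_def sorted_wrt_iff_nth_less
  by (rule arg_cong2[where f = "(\<and>)", OF refl], rule all_pairs_ordered_iff)
     (rule nxt_neq[OF assms, symmetric])

lemma anticlockwise_iff:
  assumes "2 \<le> N"
  shows "anticlockwise N js \<longleftrightarrow> clockwise N (rev js)"
proof -
  have "anticlockwise N js \<longleftrightarrow> distinct js \<and>
      (\<forall>b<length js. \<forall>a<length js. js ! b = nxt N (js ! a) \<longrightarrow> b < a)"
    unfolding anticlockwise_def by blast
  also have "\<dots> \<longleftrightarrow> distinct js \<and> sorted_wrt (\<lambda>a b. b \<noteq> nxt N a) js"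
    unfolding sorted_wrt_iff_nth_less
    by (rule arg_cong2[where f = "(\<and>)", OF refl], rule all_pairs_ordered_iff)
       (rule nxt_neq[OF assms, symmetric])
  finally show ?thesis
    by (simp add: clockwise_iff[OF assms] sorted_wrt_rev)
qed

text \<open>
  Letters act from the right end of the word. If \<open>a\<close> acts before its successor \<open>b\<close>, an integer above \<open>a + 1\<close>
  stays above \<open>a + 1\<close> until \<open>b\<close> acts, and \<open>a\<close> does not act after that, so it never gets to \<open>a\<close> or below.
\<close>

lemma no_descent_if_nxt_left:
  assumes "2 \<le> N" "distinct js" "set js \<subseteq> {1..N}" "js = us @ b # vs" "a \<in> set vs" "b = nxt N a"
  shows "\<forall>k. int a + 1 < k \<longrightarrow> int a < word_perm N js k"
proof (intro allI impI)
  fix k assume k: "int a + 1 < k"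
  obtain vs1 vs2 where vs: "vs = vs1 @ a # vs2"
    using assms(5) by (meson split_list)
  have a: "a \<in> {1..N}" and b: "b \<in> {1..N}" using assms(3,4) vs by auto
  have b_mod: "(int a + 1) mod int N = int b mod int N"
    using assms(6) nxt_mod by simp
  have barrier_b: "word_perm N ws i \<le> int a + 1 \<longleftrightarrow> i \<le> int a + 1" if "ws = vs1 @ a # vs2" for ws i
    using that assms(2-4) vs b b_mod by (intro word_perm_le_iff[of b]) auto
  have barrier_a: "word_perm N ws i \<le> int a \<longleftrightarrow> i \<le> int a" if "ws = us @ [b]" for ws i
    using that assms(2-4) vs a by (intro word_perm_le_iff[of a]) auto
  have "word_perm N js k = word_perm N (us @ [b]) (word_perm N (vs1 @ a # vs2) k)"
    using assms(4) vs by simp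
  then show "int a < word_perm N js k"
    using barrier_b[OF refl, of k] barrier_a[OF refl, of "word_perm N (vs1 @ a # vs2) k"] k by force
qed

text \<open>
  If the successor \<open>b\<close> acts before \<open>a\<close>, the integer that is at \<open>a + 2\<close> when \<open>b\<close> acts goes to \<open>a + 1\<close> and then,
  by \<open>a\<close>, to \<open>a\<close>. Together with the previous lemma this reads off the order of \<open>a\<close> and \<open>b\<close> from the
  permutation.
\<close>

lemma descent_if_nxt_right:
  assumes "2 \<le> N" "distinct js" "set js \<subseteq> {1..N}" "js = us @ a # vs" "b \<in> set vs" "b = nxt N a"
  shows "\<exists>k > int a + 1. word_perm N js k \<le> int a"
proof -
  obtain vs1 vs2 where vs: "vs = vs1 @ b # vs2"
    using assms(5) by (meson split_list)
  have a: "a \<in> {1..N}" and b: "b \<in> {1..N}" using assms(3,4) vs by auto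
  have b_mod: "(int a + 1) mod int N = int b mod int N"
    using assms(6) nxt_mod by simp
  have barrier_b: "word_perm N ws i \<le> int a + 1 \<longleftrightarrow> i \<le> int a + 1" if "ws = vs1 \<or> ws = vs2" for ws i
    using that assms(2-4) vs b b_mod by (intro word_perm_le_iff[of b]) auto
  have barrier_a: "word_perm N ws i \<le> int a \<longleftrightarrow> i \<le> int a" if "ws = us \<or> ws = vs1" for ws i
    using that assms(2-4) vs a by (intro word_perm_le_iff[of a]) auto
  have refl: "simple_refl N j (p + 1) = p" if "p mod int N = int j mod int N" for j p
    using simple_refl_involution[OF assms(1), of j p] that by (simp add: simple_refl_def)
  obtain k where k: "word_perm N vs2 k = int a + 2"
    using bij_word_perm[OF assms(1)] by (metis bij_pointE)
  have "word_perm N vs1 (int a + 1) = int a + 1"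
    using barrier_a[of vs1 "int a + 1"] barrier_b[of vs1 "int a + 1"] by simp
  then have "word_perm N js k = word_perm N us (int a)"
    using k assms(4) vs refl[OF b_mod] refl[of "int a" a] by (simp add: add.assoc)
  moreover have "word_perm N us (int a) \<le> int a"
    using barrier_a[of us "int a"] by simp
  moreover have "int a + 1 < k"
    using barrier_b[of vs2 k] k by simp
  ultimately show ?thesis by auto
qed

text \<open>
  This replaces the theorem that reduced words are connected by braid moves: it makes the choice of the reduced
  word in the definition of \<open>\<pi>\<^sub>w\<close> harmless for cyclically ordered \<open>w\<close>.
\<close>

lemma reduced_word_of_clockwise_word:
  assumes N: "2 \<le> N" and js: "clockwise N js" "set js \<subseteq> {1..N}"
    and ks: "is_reduced_word_of N ks (word_perm N js)"
  shows "clockwise N ks \<and> set ks = set js"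
proof -
  have djs: "distinct js" using js(1) by (simp add: clockwise_def)
  have ks': "distinct ks" "set ks = set js"
    using reduced_word_of_distinct_word[OF N djs js(2) ks] by auto
  have perm: "word_perm N ks = word_perm N js"
    using ks by (simp add: is_reduced_word_of_def is_word_of_def)
  have "sorted_wrt (\<lambda>b a. b \<noteq> nxt N a) ks"
  proof (rule ccontr)
    assume "\<not> ?thesis"
    then obtain i i' where i: "i < i'" "i' < length ks" "ks ! i = nxt N (ks ! i')"
      by (auto simp: sorted_wrt_iff_nth_less)
    define a b where "a = ks ! i'" and "b = ks ! i"
    have ab: "b = nxt N a" using i by (simp add: a_def b_def)
    have split: "ks = take i ks @ b # drop (Suc i) ks"
      using i unfolding b_def by (intro id_take_nth_drop) simp
    have "a \<in> set (drop (Suc i) ks)"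
      using i unfolding a_def in_set_conv_nth
      by (intro exI[of _ "i' - Suc i"]) simp
    from no_descent_if_nxt_left[OF N ks'(1) _ split this ab] ks'(2) js(2)
    have no: "\<forall>k. int a + 1 < k \<longrightarrow> int a < word_perm N js k"
      using perm by simp
    have "a \<in> set js" "b \<in> set js"
      using i(1,2) ks'(2) nth_mem[of i ks] nth_mem[of i' ks] by (simp_all add: a_def b_def)
    then obtain us vs where s: "js = us @ a # vs"
      by (meson split_list)
    have "b \<noteq> a" using ab nxt_neq[OF N] by simp
    moreover have "b \<notin> set us"
      using js(1) s ab by (auto simp: clockwise_iff[OF N] sorted_wrt_append)
    ultimately have "b \<in> set vs" using \<open>b \<in> set js\<close> s by auto
    from descent_if_nxt_right[OF N djs js(2) s this ab] no show False by force
  qed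
  then show ?thesis
    using ks' by (simp add: clockwise_iff[OF N])
qed

text \<open>
  The first letter \<open>a\<close> of one word can be moved to the front of the other: the letters before it are not
  adjacent to \<open>a\<close>, as a neighbour of \<open>a\<close> lies on the same side of \<open>a\<close> in both words.
\<close>

lemma foldr_clockwise_cong:
  fixes g :: "nat \<Rightarrow> 'a \<Rightarrow> 'a"
  assumes N: "2 \<le> N"
    and comm: "\<And>i j. \<lbrakk>i \<in> {1..N}; j \<in> {1..N}; i \<noteq> nxt N j; j \<noteq> nxt N i\<rbrakk> \<Longrightarrow> g i \<circ> g j = g j \<circ> g i"
    and "clockwise N js" "clockwise N ks" "set js = set ks" "set js \<subseteq> {1..N}"
  shows "foldr (\<lambda>j f. g j \<circ> f) js id = foldr (\<lambda>j f. g j \<circ> f) ks id"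
  using assms(3-)
proof (induction js arbitrary: ks)
  case Nil
  then show ?case by simp
next
  case (Cons a js)
  let ?F = "\<lambda>js. foldr (\<lambda>j f. g j \<circ> f) js id"
  have F_app: "?F (us @ vs) = ?F us \<circ> ?F vs" for us vs
    by (induction us) (auto simp: fun_eq_iff)
  obtain us vs where ks: "ks = us @ a # vs"
    using Cons.prems(3) by (metis list.set_intros(1) split_list)
  have "b \<noteq> nxt N a \<and> a \<noteq> nxt N b \<and> b \<in> {1..N}" if "b \<in> set us" for b
  proof -
    have "b \<in> set js"
      using that Cons.prems ks by (auto simp: clockwise_def)
    then show ?thesis
      using that Cons.prems ks by (auto simp: clockwise_iff[OF N] sorted_wrt_append)
  qed
  then have "?F us \<circ> g a = g a \<circ> ?F us"
  proof (induction us)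
    case (Cons b us)
    have "g b \<circ> g a = g a \<circ> g b"
      using Cons.prems \<open>set (a # js) \<subseteq> {1..N}\<close> by (intro comm) auto
    then show ?case
      using Cons by (simp add: fun_eq_iff)
  qed simp
  then have "?F ks = g a \<circ> ?F (us @ vs)"
    unfolding ks F_app by (simp add: fun_eq_iff)
  moreover have "?F js = ?F (us @ vs)"
    using Cons.prems ks
    by (intro Cons.IH) (auto simp: clockwise_iff[OF N] sorted_wrt_append)
  moreover have "?F (a # js) = g a \<circ> ?F js"
    by simp
  ultimately show ?case by metis
qed

text \<open>
  A proper subset of \<open>{1..N}\<close> is described by its largest missing letter \<open>m\<close> and the set \<open>S\<close> of its elements
  below \<open>m\<close>. Cutting the circle at \<open>m\<close> gives a clockwise word for this subset.
\<close>

definition gap_word :: "nat \<Rightarrow> nat \<Rightarrow> nat set \<Rightarrow> nat list" where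
  "gap_word N m S = [Suc m..<Suc N] @ sorted_list_of_set S"

definition gap_data :: "nat \<Rightarrow> (nat \<times> nat set) set" where
  "gap_data N = (SIGMA m : {1..N}. Pow {1..<m})"

lemma gap_data_finite: "finite (gap_data N)"
  by (simp add: gap_data_def)

lemma gap_word_letters:
  assumes "(m, S) \<in> gap_data N"
  shows "set (gap_word N m S) = {Suc m..N} \<union> S" "set (gap_word N m S) \<subseteq> {1..N}"
    "length (gap_word N m S) = N - m + card S"
  using assms finite_subset[of S "{1..<m}"] by (auto simp: gap_word_def gap_data_def)

lemma gap_word_clockwise:
  assumes "2 \<le> N" "(m, S) \<in> gap_data N"
  shows "clockwise N (gap_word N m S)"
proof -
  have S: "1 \<le> m" "m \<le> N" "S \<subseteq> {1..<m}" "finite S"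
    using assms(2) finite_subset[of S "{1..<m}"] by (auto simp: gap_data_def)
  have nxt_small: "nxt N a = a + 1" if "a \<in> S" for a
    using that S by (auto simp: nxt_def)
  have "sorted_wrt (\<lambda>b a. b \<noteq> nxt N a) (sorted_list_of_set S)"
    by (rule sorted_wrt_mono_rel[OF _ strict_sorted_list_of_set])
       (use S nxt_small in auto)
  moreover have "sorted_wrt (\<lambda>b a. b \<noteq> nxt N a) [Suc m..<Suc N]"
  proof (rule sorted_wrt_mono_rel[OF _ sorted_wrt_upt])
    fix b a assume "b \<in> set [Suc m..<Suc N]" "a \<in> set [Suc m..<Suc N]" "b < a"
    then show "b \<noteq> nxt N a"
      using S by (cases "a = N") (auto simp: nxt_def)
  qed
  ultimately show ?thesis
    unfolding clockwise_iff[OF assms(1)] gap_word_def sorted_wrt_append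
    using S nxt_small by auto
qed

lemma clockwise_elements_bij:
  assumes N: "2 \<le> N" and r: "r < N"
  shows "bij_betw (\<lambda>(m, S). word_perm N (gap_word N m S))
    {(m, S) \<in> gap_data N. N - m + card S = r} (clockwise_elements N r)"
proof (rule bij_betwI')
  show "(\<lambda>(m, S). word_perm N (gap_word N m S)) d \<in> clockwise_elements N r"
    if "d \<in> {(m, S) \<in> gap_data N. N - m + card S = r}" for d
  proof -
    obtain m S where "d = (m, S)"
      by (cases d)
    with that have d: "d = (m, S)" "(m, S) \<in> gap_data N" "N - m + card S = r"
      by auto
    have "is_reduced_word_of N (gap_word N m S) (word_perm N (gap_word N m S))"
      using gap_word_letters[OF d(2)] gap_word_clockwise[OF N d(2)]
      by (intro distinct_word_reduced[OF N]) (auto simp: clockwise_def)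
    then show ?thesis
      using d gap_word_letters(3)[OF d(2)] gap_word_clockwise[OF N d(2)]
        word_perm_in_affine_Sym[OF N gap_word_letters(2)[OF d(2)]]
      by (auto simp: clockwise_elements_def is_reduced_word_of_def)
  qed
next
  fix d d' assume dd: "d \<in> {(m, S) \<in> gap_data N. N - m + card S = r}"
    "d' \<in> {(m, S) \<in> gap_data N. N - m + card S = r}"
  obtain m S m' S' where "d = (m, S)" "d' = (m', S')"
    by (cases d, cases d')
  with dd have d: "d = (m, S)" "d' = (m', S')" "(m, S) \<in> gap_data N" "(m', S') \<in> gap_data N"
    by auto
  show "((\<lambda>(m, S). word_perm N (gap_word N m S)) d = (\<lambda>(m, S). word_perm N (gap_word N m S)) d') = (d = d')"
  proof
    assume "(\<lambda>(m, S). word_perm N (gap_word N m S)) d = (\<lambda>(m, S). word_perm N (gap_word N m S)) d'"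
    then have "word_perm N (gap_word N m S) = word_perm N (gap_word N m' S')"
      using d by simp
    moreover have "distinct (gap_word N m S)" "distinct (gap_word N m' S')"
      using gap_word_clockwise[OF N d(3)] gap_word_clockwise[OF N d(4)] by (simp_all add: clockwise_def)
    moreover note gap_word_letters(2)[OF d(3)] gap_word_letters(2)[OF d(4)]
    ultimately have "set (gap_word N m S) = set (gap_word N m' S')"
      using distinct_word_letters_subset[OF N] by (metis subset_antisym)
    then have eq: "{Suc m..N} \<union> S = {Suc m'..N} \<union> S'"
      using gap_word_letters(1)[OF d(3)] gap_word_letters(1)[OF d(4)] by simp
    have b: "1 \<le> m" "m \<le> N" "S \<subseteq> {1..<m}" "1 \<le> m'" "m' \<le> N" "S' \<subseteq> {1..<m'}"
      using d by (auto simp: gap_data_def)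
    have notin: "m \<notin> {Suc m..N} \<union> S" "m' \<notin> {Suc m'..N} \<union> S'"
      using b by auto
    have "\<not> m < m'"
    proof
      assume "m < m'"
      then have "m' \<in> {Suc m..N} \<union> S" using b by simp
      then show False using eq notin by blast
    qed
    moreover have "\<not> m' < m"
    proof
      assume "m' < m"
      then have "m \<in> {Suc m'..N} \<union> S'" using b by simp
      then show False using eq notin by blast
    qed
    ultimately have "m = m'" by simp
    moreover have "S = ({Suc m..N} \<union> S) \<inter> {1..<m}" "S' = ({Suc m'..N} \<union> S') \<inter> {1..<m'}"
      using b by auto
    ultimately show "d = d'" using eq d by metis
  qed simp
next
  fix w assume "w \<in> clockwise_elements N r"
  then obtain js where js: "set js \<subseteq> {1..N}" "word_perm N js = w" "length js = r" "clockwise N js"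
    by (auto simp: clockwise_elements_def is_reduced_word_of_def is_word_of_def)
  have "card (set js) < card {1..N}"
    using js(3) r card_length[of js] by simp
  then have ne: "{1..N} - set js \<noteq> {}"
    using js(1) by (metis Diff_eq_empty_iff less_irrefl subset_antisym)
  \<comment> \<open>The word has fewer than \<open>N\<close> letters, so there is a gap at which the circle can be cut.\<close>
  define m where "m = Max ({1..N} - set js)"
  define S where "S = set js \<inter> {1..<m}"
  have m: "m \<in> {1..N} - set js" and max: "\<And>k. k \<in> {1..N} - set js \<Longrightarrow> k \<le> m"
    using Max_in[OF _ ne] Max_ge[of "{1..N} - set js"] by (simp_all add: m_def)
  have mem: "(m, S) \<in> gap_data N"
    using m by (auto simp: gap_data_def S_def)
  have set_js: "set (gap_word N m S) = set js"
  proof -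
    have "i \<in> set js" if "i \<in> {Suc m..N}" for i
      using that max[of i] by force
    moreover have "i \<in> {Suc m..N} \<union> {1..<m}" if "i \<in> set js" for i
      using that m js(1) by (cases i m rule: linorder_cases) auto
    ultimately show ?thesis
      unfolding gap_word_letters(1)[OF mem] unfolding S_def by blast
  qed
  have "word_perm N js = word_perm N (gap_word N m S)"
    unfolding word_perm_def
    by (rule foldr_clockwise_cong[OF N simple_refl_comm[OF N] js(4) gap_word_clockwise[OF N mem]
        set_js[symmetric] js(1)])
  moreover have "length (gap_word N m S) = r"
    using distinct_card[of js] distinct_card[of "gap_word N m S"] set_js js(3,4)
      gap_word_clockwise[OF N mem] by (simp add: clockwise_def)
  ultimately have "(m, S) \<in> {(m, S) \<in> gap_data N. N - m + card S = r}"
      "w = (\<lambda>(m, S). word_perm N (gap_word N m S)) (m, S)"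
    using mem gap_word_letters(3)[OF mem] js(2) by simp_all
  then show "\<exists>d\<in>{(m, S) \<in> gap_data N. N - m + card S = r}. w = (\<lambda>(m, S). word_perm N (gap_word N m S)) d"
    by (rule bexI[rotated])
qed

lemma reduced_word_clockwise:
  assumes N: "2 \<le> N" and js: "clockwise N js" "set js \<subseteq> {1..N}"
  shows "clockwise N (reduced_word N (word_perm N js)) \<and> set (reduced_word N (word_perm N js)) = set js"
proof -
  have "is_reduced_word_of N js (word_perm N js)"
    using distinct_word_reduced[OF N _ js(2)] js(1) by (simp add: clockwise_def)
  then have "is_reduced_word_of N (reduced_word N (word_perm N js)) (word_perm N js)"
    unfolding reduced_word_def by (rule someI)
  then show ?thesis
    by (rule reduced_word_of_clockwise_word[OF assms])
qed

lemma sum_clockwise_elements: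
  fixes F :: "nat list \<Rightarrow> 'b::comm_monoid_add"
  assumes N: "2 \<le> N" and r: "r < N"
    and F: "\<And>js ks. \<lbrakk>clockwise N js; clockwise N ks; set js = set ks; set js \<subseteq> {1..N}\<rbrakk> \<Longrightarrow> F js = F ks"
  shows "(\<Sum>w\<in>clockwise_elements N r. F (reduced_word N w))
    = (\<Sum>(m, S)\<in>{(m, S) \<in> gap_data N. N - m + card S = r}. F (gap_word N m S))"
proof -
  have "F (reduced_word N (word_perm N (gap_word N m S))) = F (gap_word N m S)"
    if "(m, S) \<in> gap_data N" for m S
  proof (rule F)
    note g = gap_word_clockwise[OF N that] gap_word_letters(2)[OF that]
    show "clockwise N (gap_word N m S)" by (rule g)
    show "clockwise N (reduced_word N (word_perm N (gap_word N m S)))"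
      "set (reduced_word N (word_perm N (gap_word N m S))) = set (gap_word N m S)"
      using reduced_word_clockwise[OF N g] by blast+
    then show "set (reduced_word N (word_perm N (gap_word N m S))) \<subseteq> {1..N}"
      using g by simp
  qed
  then have "(\<Sum>(m, S)\<in>{(m, S) \<in> gap_data N. N - m + card S = r}. F (gap_word N m S))
      = (\<Sum>d\<in>{(m, S) \<in> gap_data N. N - m + card S = r}.
          F (reduced_word N ((\<lambda>(m, S). word_perm N (gap_word N m S)) d)))"
    by (intro sum.cong refl) (simp split: prod.splits)
  also have "\<dots> = (\<Sum>w\<in>clockwise_elements N r. F (reduced_word N w))"
    by (rule sum.reindex_bij_betw[OF clockwise_elements_bij[OF N r], of "\<lambda>w. F (reduced_word N w)"])
  finally show ?thesis by (rule sym)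
qed

lemma is_word_of_rev:
  assumes "2 \<le> N" "is_word_of N js w"
  shows "is_word_of N (rev js) (inv_into UNIV w)"
  using assms by (auto simp: is_word_of_def inv_word_perm)

lemma aff_length_inv:
  assumes "2 \<le> N" "is_word_of N js w"
  shows "aff_length N (inv_into UNIV w) = aff_length N w"
proof -
  have "inv_into UNIV (inv_into UNIV w) = w"
    using assms(2) inv_inv_eq[OF bij_word_perm[OF assms(1), of js]] by (simp add: is_word_of_def)
  then have "(\<exists>ks. is_word_of N ks (inv_into UNIV w) \<and> length ks = r)
      \<longleftrightarrow> (\<exists>ks. is_word_of N ks w \<and> length ks = r)" for r
    using is_word_of_rev[OF assms(1), of _ w] is_word_of_rev[OF assms(1), of _ "inv_into UNIV w"]
    by (metis length_rev)
  then have "(\<lambda>r. \<exists>ks. is_word_of N ks (inv_into UNIV w) \<and> length ks = r)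
      = (\<lambda>r. \<exists>ks. is_word_of N ks w \<and> length ks = r)"
    by (rule ext)
  then show ?thesis
    unfolding aff_length_def by (rule arg_cong[where f = Least])
qed

lemma is_reduced_word_of_rev:
  assumes "2 \<le> N" "is_reduced_word_of N js w"
  shows "is_reduced_word_of N (rev js) (inv_into UNIV w)"
  using assms(2) is_word_of_rev[OF assms(1), of js w] aff_length_inv[OF assms(1), of js w]
  by (simp add: is_reduced_word_of_def)

lemma anticlockwise_elements_bij:
  assumes N: "2 \<le> N"
  shows "bij_betw (inv_into UNIV) (clockwise_elements N r) (anticlockwise_elements N r)"
proof (rule bij_betw_byWitness[where f' = "inv_into UNIV"])
  have inverse_word: "inv_into UNIV w \<in> affine_Sym N" "aff_length N (inv_into UNIV w) = aff_length N w"
      "is_reduced_word_of N (rev js) (inv_into UNIV w)"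
    if "is_reduced_word_of N js w" for js w
    using that word_perm_in_affine_Sym[OF N, of "rev js"] aff_length_inv[OF N, of js w]
      is_reduced_word_of_rev[OF N that]
    by (auto simp: is_reduced_word_of_def is_word_of_def inv_word_perm[OF N])
  show "inv_into UNIV ` clockwise_elements N r \<subseteq> anticlockwise_elements N r"
  proof safe
    fix w assume "w \<in> clockwise_elements N r"
    then obtain js where js: "is_reduced_word_of N js w" "clockwise N js" "aff_length N w = r"
      by (auto simp: clockwise_elements_def)
    moreover have "anticlockwise N (rev js)"
      using js(2) by (simp add: anticlockwise_iff[OF N])
    ultimately show "inv_into UNIV w \<in> anticlockwise_elements N r"
      using inverse_word[OF js(1)] unfolding anticlockwise_elements_def by blast
  qed
  show "inv_into UNIV ` anticlockwise_elements N r \<subseteq> clockwise_elements N r"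
  proof safe
    fix w assume "w \<in> anticlockwise_elements N r"
    then obtain js where js: "is_reduced_word_of N js w" "anticlockwise N js" "aff_length N w = r"
      by (auto simp: anticlockwise_elements_def)
    moreover have "clockwise N (rev js)"
      using js(2) by (simp add: anticlockwise_iff[OF N])
    ultimately show "inv_into UNIV w \<in> clockwise_elements N r"
      using inverse_word[OF js(1)] unfolding clockwise_elements_def by blast
  qed
qed (auto simp: clockwise_elements_def anticlockwise_elements_def affine_Sym_def inv_inv_eq)

lemma sum_anticlockwise_elements:
  fixes F :: "nat list \<Rightarrow> 'b::comm_monoid_add"
  assumes N: "2 \<le> N" and r: "r < N"
    and F: "\<And>js ks. \<lbrakk>clockwise N js; clockwise N ks; set js = set ks; set js \<subseteq> {1..N}\<rbrakk>
      \<Longrightarrow> F (rev js) = F (rev ks)"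
  shows "(\<Sum>w\<in>anticlockwise_elements N r. F (reduced_word N w))
    = (\<Sum>(m, S)\<in>{(m, S) \<in> gap_data N. N - m + card S = r}. F (rev (gap_word N m S)))"
proof -
  have "F (reduced_word N (inv_into UNIV w)) = F (rev (reduced_word N w))" if w: "w \<in> clockwise_elements N r" for w
  proof -
    obtain js where js': "clockwise N js" "is_reduced_word_of N js w"
      using w unfolding clockwise_elements_def by blast
    then have js: "set js \<subseteq> {1..N}" "word_perm N js = w" "clockwise N js" "is_reduced_word_of N js w"
      by (auto simp: is_reduced_word_of_def is_word_of_def)
    have "is_reduced_word_of N (reduced_word N (inv_into UNIV w)) (inv_into UNIV w)"
      unfolding reduced_word_def by (rule someI) (rule is_reduced_word_of_rev[OF N js(4)])
    from is_reduced_word_of_rev[OF N this]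
    have "is_reduced_word_of N (rev (reduced_word N (inv_into UNIV w))) w"
      using inv_inv_eq[OF bij_word_perm[OF N, of js]] js(2) by simp
    then have "clockwise N (rev (reduced_word N (inv_into UNIV w))) 
        \<and> set (reduced_word N (inv_into UNIV w)) = set js"
      using reduced_word_of_clockwise_word[OF N js(3,1)] js(2) by force
    then have "F (rev (rev (reduced_word N (inv_into UNIV w)))) = F (rev (reduced_word N w))"
      using reduced_word_clockwise[OF N js(3,1)] js(1,2) by (intro F) auto
    then show ?thesis by simp
  qed
  then have "(\<Sum>w\<in>anticlockwise_elements N r. F (reduced_word N w))
      = (\<Sum>w\<in>clockwise_elements N r. F (rev (reduced_word N w)))"
    using sum.reindex_bij_betw[OF anticlockwise_elements_bij[OF N], of "\<lambda>w. F (reduced_word N w)" r]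
    by simp
  also have "\<dots> = (\<Sum>(m, S)\<in>{(m, S) \<in> gap_data N. N - m + card S = r}. F (rev (gap_word N m S)))"
    by (rule sum_clockwise_elements[OF N r, where F = "\<lambda>js. F (rev js)"]) (rule F)
  finally show ?thesis .
qed


section \<open>Monodromy matrices over a ring with commuting sites\<close>

text \<open>
  Ring elements that commute are tracked by hand through sums and products, because as rewrite rules such
  equations do not terminate.
\<close>

lemma commute_add:
  fixes a b c :: "'r::ring"
  shows "a * b = b * a \<Longrightarrow> a * c = c * a \<Longrightarrow> a * (b + c) = (b + c) * a"
  by (simp add: algebra_simps)

lemma commute_mult:
  fixes a b c :: "'r::semigroup_mult"
  shows "a * b = b * a \<Longrightarrow> a * c = c * a \<Longrightarrow> a * (b * c) = (b * c) * a"
  by (metis mult.assoc)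

lemma commute_prod_list:
  fixes a :: "'r::monoid_mult"
  shows "(\<And>b. b \<in> set bs \<Longrightarrow> a * b = b * a) \<Longrightarrow> a * prod_list bs = prod_list bs * a"
  by (induction bs) (auto intro!: commute_mult)

lemma sorted_list_of_set_insert_greater:
  fixes k :: nat
  assumes "finite S" "\<And>i. i \<in> S \<Longrightarrow> i < k"
  shows "sorted_list_of_set (insert k S) = sorted_list_of_set S @ [k]"
proof (rule sorted_distinct_set_unique)
  show "set (sorted_list_of_set (insert k S)) = set (sorted_list_of_set S @ [k])"
    using assms(1) by (simp only: set_sorted_list_of_set finite_insert set_append) auto
qed (use assms in \<open>auto simp: sorted_append less_imp_le simp del: sorted_list_of_set_insert_remove\<close>)

text \<open>
  The elements \<open>sp j\<close> and \<open>sm j\<close> stand for the raising and lowering operators at site \<open>j\<close> of a chain, and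
  \<open>d j\<close> for the diagonal term of the local operator. That \<open>d j\<close> belongs to site \<open>j\<close> is expressed by
  \<open>d_local\<close>, which leaves its form open; it differs for \<open>E\<close> and \<open>H\<close>. By \<open>sp_d\<close> no particle arrives at a
  site after the diagonal term has acted there.
\<close>

locale site_ring =
  fixes x q :: "'r::ring_1" and sp sm d :: "nat \<Rightarrow> 'r" and N :: nat
  assumes x_central: "x * a = a * x" and q_central: "q * a = a * q"
    and sites_commute: "i \<noteq> j \<Longrightarrow> sp i * sp j = sp j * sp i"
      "i \<noteq> j \<Longrightarrow> sm i * sm j = sm j * sm i" "i \<noteq> j \<Longrightarrow> sp i * sm j = sm j * sp i"
    and d_local: "\<lbrakk>a * sp j = sp j * a; a * sm j = sm j * a\<rbrakk> \<Longrightarrow> a * d j = d j * a"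
    and sp_d: "sp j * d j = 0"
    and N: "2 \<le> N"
begin

definition p :: "nat \<Rightarrow> 'r" where
  "p j = (if j = N then q else 1) * (sm j * sp (nxt N j)) + d j"

primrec P :: "nat \<Rightarrow> 'r" where
  "P 0 = 1"
| "P (Suc k) = P k * (1 + x * p (Suc k))"

text \<open>
  These are the entries of the monodromy matrix of the first \<open>k + 1\<close> sites; that they satisfy its
  recursion is the content of \<open>entries_0\<close> and \<open>entries_left\<close>.
\<close>

definition A :: "nat \<Rightarrow> 'r" where "A k = P k * (1 + x * d (Suc k))"
definition C :: "nat \<Rightarrow> 'r" where "C k = P k * sm (Suc k)"
definition B :: "nat \<Rightarrow> 'r" where "B k = x * sp 1 * A k"
definition D :: "nat \<Rightarrow> 'r" where "D k = x * sp 1 * C k"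

lemma p_bulk: "j < N \<Longrightarrow> p j = sm j * sp (Suc j) + d j"
  by (simp add: p_def nxt_def)

text \<open>
  An element with this property commutes with everything at site \<open>i\<close>, including \<open>d i\<close>.
\<close>

definition avoids :: "'r \<Rightarrow> nat \<Rightarrow> bool" where
  "avoids a i \<longleftrightarrow> a * sp i = sp i * a \<and> a * sm i = sm i * a"

lemma avoids_d: "avoids a i \<Longrightarrow> a * d i = d i * a"
  by (simp add: avoids_def d_local)

lemma site_avoids:
  assumes "i \<noteq> j"
  shows "avoids (sp j) i" "avoids (sm j) i" "avoids (d j) i"
proof -
  show "avoids (sp j) i" "avoids (sm j) i"
    using assms sites_commute[of i j] sites_commute[of j i] by (auto simp: avoids_def)
  then show "avoids (d j) i"
    using d_local[of "sp i" j] d_local[of "sm i" j] by (simp add: avoids_def)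
qed

lemma avoids_p:
  assumes "j < N" "\<And>i. i \<in> {j, Suc j} \<Longrightarrow> avoids a i"
  shows "a * p j = p j * a"
  unfolding p_bulk[OF assms(1)]
  using assms(2)[of j] assms(2)[of "Suc j"] avoids_d[of a j]
  by (intro commute_add commute_mult) (auto simp: avoids_def)

lemma avoids_P:
  assumes "k < N" "\<And>i. i \<in> {1..Suc k} \<Longrightarrow> avoids a i"
  shows "a * P k = P k * a"
  using assms
proof (induction k)
  case (Suc k)
  have "a * P k = P k * a"
    using Suc.prems by (intro Suc.IH) auto
  moreover have "a * p (Suc k) = p (Suc k) * a"
    using Suc.prems by (intro avoids_p) auto
  ultimately show ?case
    using x_central[of a] by (simp add: commute_mult commute_add)
qed simp

text \<open>
  Here the new site is multiplied from the right, which is immediate from the recursion of \<open>P\<close>: the term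
  \<open>\<sigma>\<^sup>+ d\<close> that is absent in the monodromy matrix vanishes. Monodromy matrices multiply the new site from the
  left; the two agree by \<open>entries_commute\<close>, and in the opposite ring left and right change roles.
\<close>

lemma A_right: "Suc k < N \<Longrightarrow> A (Suc k) = A k * (1 + x * d (k + 2)) + C k * (x * sp (k + 2))"
  and C_right: "Suc k < N \<Longrightarrow> C (Suc k) = A k * sm (k + 2) + C k * (x * (sp (k + 2) * sm (k + 2)))"
proof -
  assume k: "Suc k < N"
  have "sm (Suc k) * (x * b) = x * (sm (Suc k) * b)" "sp (k + 2) * (x * d (k + 2)) = 0" for b
    using x_central[of "sm (Suc k)"] x_central[of "sp (k + 2)"] sp_d[of "k + 2"]
    by (metis mult.assoc, metis mult.assoc mult_zero_right)
  then show "A (Suc k) = A k * (1 + x * d (k + 2)) + C k * (x * sp (k + 2))"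
      "C (Suc k) = A k * sm (k + 2) + C k * (x * (sp (k + 2) * sm (k + 2)))"
    by (simp_all add: A_def C_def p_bulk[OF k] algebra_simps)
qed

lemma B_right: "Suc k < N \<Longrightarrow> B (Suc k) = B k * (1 + x * d (k + 2)) + D k * (x * sp (k + 2))"
  and D_right: "Suc k < N \<Longrightarrow> D (Suc k) = B k * sm (k + 2) + D k * (x * (sp (k + 2) * sm (k + 2)))"
  by (simp_all add: B_def D_def A_right C_right distrib_left mult.assoc)

lemma entries_commute:
  assumes "k < N" "k + 1 < j" "a \<in> {sp j, sm j, d j}"
  shows "a * A k = A k * a" "a * B k = B k * a" "a * C k = C k * a" "a * D k = D k * a"
proof -
  have av: "avoids a i" if "i \<in> {1..Suc k}" for i
    using that assms(2,3) site_avoids[of i j] by auto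
  show "a * A k = A k * a" "a * C k = C k * a"
    unfolding A_def C_def
    using avoids_P[OF assms(1) av] av[of "Suc k"] avoids_d[of a "Suc k"] x_central[of a]
    by (auto intro!: commute_mult commute_add simp: avoids_def)
  then show "a * B k = B k * a" "a * D k = D k * a"
    unfolding B_def D_def using av[of 1] x_central[of a]
    by (auto intro!: commute_mult simp: avoids_def)
qed

lemma entries_left:
  assumes k: "Suc k < N"
  shows "A (Suc k) = (1 + x * d (k + 2)) * A k + x * sp (k + 2) * C k"
    "B (Suc k) = (1 + x * d (k + 2)) * B k + x * sp (k + 2) * D k"
    "C (Suc k) = sm (k + 2) * A k + x * (sp (k + 2) * sm (k + 2)) * C k"
    "D (Suc k) = sm (k + 2) * B k + x * (sp (k + 2) * sm (k + 2)) * D k"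
proof -
  have *: "(1 + x * d (k + 2)) * M = M * (1 + x * d (k + 2))" "x * sp (k + 2) * M = M * (x * sp (k + 2))"
    "sm (k + 2) * M = M * sm (k + 2)"
    "x * (sp (k + 2) * sm (k + 2)) * M = M * (x * (sp (k + 2) * sm (k + 2)))"
    if "M \<in> {A k, B k, C k, D k}" for M
  proof -
    have "a * M = M * a" if "a \<in> {sp (k + 2), sm (k + 2), d (k + 2)}" for a
      using entries_commute[OF _ _ that, of k] k \<open>M \<in> _\<close> by (elim insertE emptyE) simp_all
    then have Md: "M * d (k + 2) = d (k + 2) * M" and Mp: "M * sp (k + 2) = sp (k + 2) * M"
      and Mm: "M * sm (k + 2) = sm (k + 2) * M"
      by (metis insertCI)+
    have Mx: "M * x = x * M" by (rule x_central[symmetric])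
    show "(1 + x * d (k + 2)) * M = M * (1 + x * d (k + 2))"
      by (rule commute_add[OF _ commute_mult[OF Mx Md], symmetric]) simp
    show "x * sp (k + 2) * M = M * (x * sp (k + 2))"
      by (rule commute_mult[OF Mx Mp, symmetric])
    show "sm (k + 2) * M = M * sm (k + 2)"
      by (rule Mm[symmetric])
    show "x * (sp (k + 2) * sm (k + 2)) * M = M * (x * (sp (k + 2) * sm (k + 2)))"
      by (rule commute_mult[OF Mx commute_mult[OF Mp Mm], symmetric])
  qed
  show "A (Suc k) = (1 + x * d (k + 2)) * A k + x * sp (k + 2) * C k"
    "B (Suc k) = (1 + x * d (k + 2)) * B k + x * sp (k + 2) * D k"
    "C (Suc k) = sm (k + 2) * A k + x * (sp (k + 2) * sm (k + 2)) * C k"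
    "D (Suc k) = sm (k + 2) * B k + x * (sp (k + 2) * sm (k + 2)) * D k"
    using * by (simp_all add: A_right[OF k] B_right[OF k] C_right[OF k] D_right[OF k])
qed

lemma entries_0:
  "A 0 = 1 + x * d 1" "B 0 = x * sp 1" "C 0 = sm 1" "D 0 = x * (sp 1 * sm 1)"
proof -
  have "sp 1 * (x * d 1) = 0"
    using x_central[of "sp 1"] sp_d[of 1] by (metis mult.assoc mult_zero_right)
  then show "A 0 = 1 + x * d 1" "B 0 = x * sp 1" "C 0 = sm 1" "D 0 = x * (sp 1 * sm 1)"
    by (simp_all add: A_def B_def C_def D_def distrib_left mult.assoc)
qed

lemma x_power_central: "x ^ k * a = a * x ^ k"
proof (induction k)
  case (Suc k)
  have "x ^ Suc k * a = x * a * x ^ k"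
    by (simp add: Suc mult.assoc)
  then show ?case
    by (simp add: x_central[of a] mult.assoc)
qed simp

lemma x_power_left: "a * (x ^ k * b) = x ^ k * (a * b)"
  by (metis x_power_central mult.assoc)

text \<open>
  The summand \<open>m\<close> collects the terms of the product in which \<open>x p\<^sub>m\<close> is the last factor that was not chosen.
\<close>

lemma P_largest_gap:
  "P k = (\<Sum>m = 1..k. x ^ (k - m) * (P (m - 1) * prod_list (map p [Suc m..<Suc k])))
    + x ^ k * prod_list (map p [1..<Suc k])"
proof (induction k)
  case (Suc k)
  let ?f = "\<lambda>k m. x ^ (k - m) * (P (m - 1) * prod_list (map p [Suc m..<Suc k]))"
  have step: "?f k m * (x * p (Suc k)) = ?f (Suc k) m" if "m \<in> {1..k}" for m
  proof -
    have "?f k m * (x * p (Suc k)) = x * (?f k m * p (Suc k))"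
      by (metis x_central mult.assoc)
    also have "\<dots> = ?f (Suc k) m"
      using that by (simp add: Suc_diff_le mult.assoc)
    finally show ?thesis .
  qed
  have "P (Suc k) = P k + P k * (x * p (Suc k))"
    by (simp add: distrib_left)
  also have "P k * (x * p (Suc k)) = (\<Sum>m = 1..k. ?f k m * (x * p (Suc k)))
      + x ^ k * prod_list (map p [1..<Suc k]) * (x * p (Suc k))"
    by (subst Suc) (simp only: distrib_right sum_distrib_right)
  also have "(\<Sum>m = 1..k. ?f k m * (x * p (Suc k))) = (\<Sum>m = 1..k. ?f (Suc k) m)"
    using step by (rule sum.cong[OF refl])
  also have "x ^ k * prod_list (map p [1..<Suc k]) * (x * p (Suc k))
      = x * (x ^ k * (prod_list (map p [1..<Suc k]) * p (Suc k)))"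
    by (metis x_central mult.assoc)
  also have "\<dots> = x ^ Suc k * prod_list (map p [1..<Suc (Suc k)])"
    by (simp add: mult.assoc)
  finally show ?case by (simp add: add.assoc add.left_commute)
qed simp

text \<open>
  Besides \<open>P\<^sub>N\<^sub>-\<^sub>1\<close>, the trace consists of \<open>x P\<^sub>N\<^sub>-\<^sub>1 d\<^sub>N\<close> and \<open>x q \<sigma>\<^sup>+\<^sub>1 P\<^sub>N\<^sub>-\<^sub>1 \<sigma>\<^sup>-\<^sub>N\<close>. In a term of \<open>P\<^sub>N\<^sub>-\<^sub>1\<close> with
  a gap at \<open>m\<close>, the factors above \<open>m\<close> commute with those below, with the effect that the ring closes at the
  site \<open>N\<close>: the two contributions add up to a factor \<open>p\<^sub>N\<close>. The terms without a gap form the remainder, which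
  is a multiple of \<open>x\<^sup>N\<close>.
\<close>

lemma trace_largest_gap:
  "\<exists>R. A (N - 1) + q * D (N - 1)
    = (\<Sum>m = 1..N. x ^ (N - m) * (prod_list (map p [Suc m..<Suc N]) * P (m - 1))) + x ^ N * R"
proof -
  define n where "n = N - 1"
  have Nn: "N = Suc n" and n: "1 \<le> n" using N by (auto simp: n_def)
  define tl where "tl m = prod_list (map p [Suc m..<Suc n])" for m
  define full where "full = prod_list (map p [1..<Suc n])"
  have close_ring: "P (m - 1) * tl m * d N + q * sp 1 * (P (m - 1) * tl m) * sm N
      = tl m * p N * P (m - 1)" if m: "m \<in> {1..n}" for m
  proof -
    have P_site: "a * P (m - 1) = P (m - 1) * a" if "a \<in> {sp j, sm j, d j}" "m < j" for a j
      using that m Nn site_avoids[of _ j] by (intro avoids_P) auto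
    have P_avoids: "avoids (P (m - 1)) i" if "m < i" for i
      unfolding avoids_def using P_site[OF _ that] by (metis insertCI)
    have P_tl: "P (m - 1) * tl m = tl m * P (m - 1)"
      unfolding tl_def
    proof (rule commute_prod_list)
      fix b assume "b \<in> set (map p [Suc m..<Suc n])"
      then obtain j where j: "b = p j" "m < j" "j < N" using Nn by auto
      show "P (m - 1) * b = b * P (m - 1)"
        unfolding j(1)
        using j P_avoids by (intro avoids_p) auto
    qed
    have sp_tl: "sp 1 * tl m = tl m * sp 1"
      unfolding tl_def
    proof (rule commute_prod_list)
      fix b assume "b \<in> set (map p [Suc m..<Suc n])"
      then obtain j where j: "b = p j" "m < j" "j < N" using Nn by auto
      show "sp 1 * b = b * sp 1"
        unfolding j(1) using j m by (intro avoids_p site_avoids) auto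
    qed
    \<comment> \<open>The last hop leads back to site \<open>1\<close>, which differs from \<open>N\<close>.\<close>
    have pN: "p N = d N + q * (sp 1 * sm N)"
      using sites_commute(3)[of 1 N] N by (simp add: p_def nxt_def)
    have "P (m - 1) * tl m * d N = tl m * (P (m - 1) * d N)"
      unfolding P_tl by (rule mult.assoc)
    also have "\<dots> = tl m * d N * P (m - 1)"
      using P_site[of "d N" N] m Nn by (simp add: mult.assoc)
    finally have 1: "P (m - 1) * tl m * d N = tl m * d N * P (m - 1)" .
    have "q * sp 1 * (P (m - 1) * tl m) * sm N = q * (sp 1 * tl m) * (P (m - 1) * sm N)"
      unfolding P_tl by (simp only: mult.assoc)
    also have "\<dots> = q * tl m * (sp 1 * sm N) * P (m - 1)"
      unfolding sp_tl using P_site[of "sm N" N] m Nn by (simp add: mult.assoc)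
    also have "\<dots> = tl m * (q * (sp 1 * sm N)) * P (m - 1)"
      by (simp only: q_central[of "tl m"] mult.assoc)
    finally show ?thesis
      unfolding 1 pN by (simp add: algebra_simps)
  qed
  have n_P: "P n = (\<Sum>m = 1..n. x ^ (n - m) * (P (m - 1) * tl m)) + x ^ n * full"
    using P_largest_gap[of n] by (simp add: tl_def full_def)
  have "P n * d N + q * sp 1 * P n * sm N
      = (\<Sum>m = 1..n. x ^ (n - m) * (P (m - 1) * tl m * d N + q * sp 1 * (P (m - 1) * tl m) * sm N))
        + x ^ n * (full * d N + q * sp 1 * full * sm N)"
    unfolding n_P
    by (simp add: distrib_left distrib_right sum_distrib_left sum_distrib_right sum.distrib mult.assoc x_power_left)
  also have "\<dots> = (\<Sum>m = 1..n. x ^ (n - m) * (tl m * p N * P (m - 1)))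
        + x ^ n * (full * d N + q * sp 1 * full * sm N)"
    using close_ring by simp
  finally have *: "P n * d N + q * sp 1 * P n * sm N = (\<Sum>m = 1..n. x ^ (n - m) * (tl m * p N * P (m - 1)))
        + x ^ n * (full * d N + q * sp 1 * full * sm N)" .
  have "A n + q * D n = P n + x * (P n * d N + q * sp 1 * P n * sm N)"
    unfolding A_def D_def C_def Nn[symmetric]
    using x_central[of "P n"] x_central[of q] by (simp add: distrib_left mult.assoc[symmetric])
  also have "\<dots> = P n + (\<Sum>m = 1..n. x ^ (N - m) * (tl m * p N * P (m - 1)))
        + x ^ N * (full * d N + q * sp 1 * full * sm N)"
    unfolding * by (simp add: distrib_left sum_distrib_left Nn Suc_diff_le mult.assoc add.assoc)
  also have "P n + (\<Sum>m = 1..n. x ^ (N - m) * (tl m * p N * P (m - 1)))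
      = (\<Sum>m = 1..N. x ^ (N - m) * (prod_list (map p [Suc m..<Suc N]) * P (m - 1)))"
    by (simp add: Nn tl_def add.commute)
  finally show ?thesis
    unfolding n_def by blast
qed

lemma P_subsets:
  "P k = (\<Sum>S\<in>Pow {1..<Suc k}. x ^ card S * prod_list (map p (sorted_list_of_set S)))"
proof (induction k)
  case (Suc k)
  let ?f = "\<lambda>S. x ^ card S * prod_list (map p (sorted_list_of_set S))"
  let ?I = "{1..<Suc k}"
  have "{1..<Suc (Suc k)} = insert (Suc k) ?I" by auto
  then have "(\<Sum>S\<in>Pow {1..<Suc (Suc k)}. ?f S) = (\<Sum>S\<in>Pow ?I. ?f S) + (\<Sum>S\<in>insert (Suc k) ` Pow ?I. ?f S)"
    by (simp only: Pow_insert) (rule sum.union_disjoint, auto)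
  also have "(\<Sum>S\<in>insert (Suc k) ` Pow ?I. ?f S) = (\<Sum>S\<in>Pow ?I. ?f (insert (Suc k) S))"
    by (rule sum.reindex_cong[OF _ refl refl], rule inj_onI, subst (asm) insert_ident) auto
  also have "\<dots> = (\<Sum>S\<in>Pow ?I. ?f S * (x * p (Suc k)))"
  proof (rule sum.cong[OF refl])
    fix S assume "S \<in> Pow ?I"
    then have S: "finite S" "\<And>i. i \<in> S \<Longrightarrow> i < Suc k" using finite_subset[of S ?I] by auto
    have "card (insert (Suc k) S) = Suc (card S)" using S by (auto simp: card_insert_if)
    then have "?f (insert (Suc k) S) = x ^ card S * (x * prod_list (map p (sorted_list_of_set S)) * p (Suc k))"
      by (simp only: sorted_list_of_set_insert_greater[OF S] power_Suc2 map_append list.map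
          prod_list.append prod_list.Cons prod_list.Nil mult_1_right mult.assoc)
    also have "\<dots> = ?f S * (x * p (Suc k))"
      by (simp only: x_central[of "prod_list (map p (sorted_list_of_set S))"] mult.assoc)
    finally show "?f (insert (Suc k) S) = ?f S * (x * p (Suc k))" .
  qed
  also have "(\<Sum>S\<in>Pow ?I. ?f S) + \<dots> = P (Suc k)"
    by (simp only: Suc P.simps distrib_left mult_1_right sum_distrib_right)
  finally show ?case by (rule sym)
qed simp

lemma trace_expansion:
  "\<exists>R. A (N - 1) + q * D (N - 1)
    = (\<Sum>(m, S)\<in>gap_data N. x ^ (N - m + card S) * prod_list (map p (gap_word N m S))) + x ^ N * R"
proof -
  have "(\<Sum>(m, S)\<in>gap_data N. x ^ (N - m + card S) * prod_list (map p (gap_word N m S)))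
      = (\<Sum>m = 1..N. \<Sum>S\<in>Pow {1..<m}. x ^ (N - m + card S) * prod_list (map p (gap_word N m S)))"
    unfolding gap_data_def by (rule sum.Sigma[symmetric]) auto
  also have "\<dots> = (\<Sum>m = 1..N. x ^ (N - m) * (prod_list (map p [Suc m..<Suc N]) * P (m - 1)))"
  proof (rule sum.cong[OF refl])
    fix m assume "m \<in> {1..N}"
    then have "P (m - 1) = (\<Sum>S\<in>Pow {1..<m}. x ^ card S * prod_list (map p (sorted_list_of_set S)))"
      using P_subsets[of "m - 1"] by simp
    then show "(\<Sum>S\<in>Pow {1..<m}. x ^ (N - m + card S) * prod_list (map p (gap_word N m S)))
        = x ^ (N - m) * (prod_list (map p [Suc m..<Suc N]) * P (m - 1))"
      by (simp only: gap_word_def map_append prod_list.append sum_distrib_left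
          x_power_left[of "prod_list (map p [Suc m..<Suc N])"] power_add mult.assoc)
  qed
  finally show ?thesis
    using trace_largest_gap by simp
qed

end


section \<open>The ring of linear operators and its opposite\<close>

definition linear_opr :: "'a::comm_ring_1 opr \<Rightarrow> bool" where
  "linear_opr F \<longleftrightarrow> (\<forall>\<psi> \<phi>. F (\<psi> + \<phi>) = F \<psi> + F \<phi>) \<and> (\<forall>c \<psi>. F (smul c \<psi>) = smul c (F \<psi>))"

lemma smul_add: "smul c (\<psi> + \<phi> :: 'a::comm_ring_1 vec) = smul c \<psi> + smul c \<phi>"
  by (simp add: smul_def fun_eq_iff distrib_left)

lemma smul_diff: "smul c (\<psi> - \<phi> :: 'a::comm_ring_1 vec) = smul c \<psi> - smul c \<phi>"
  by (simp add: smul_def fun_eq_iff right_diff_distrib)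

lemma smul_uminus: "smul c (- \<psi> :: 'a::comm_ring_1 vec) = - smul c \<psi>"
  by (simp add: smul_def fun_eq_iff)

lemma smul_smul: "smul c (smul c' \<psi> :: 'a::comm_ring_1 vec) = smul (c * c') \<psi>"
  by (simp add: smul_def fun_eq_iff mult.assoc)

lemma smul_1 [simp]: "smul 1 (\<psi> :: 'a::comm_ring_1 vec) = \<psi>"
  by (simp add: smul_def)

lemma smul_0 [simp]: "smul 0 (\<psi> :: 'a::comm_ring_1 vec) = 0" "smul c (0 :: 'a::comm_ring_1 vec) = 0"
  by (simp_all add: smul_def fun_eq_iff)

lemma linear_opr_ops:
  fixes F G :: "'a::comm_ring_1 opr"
  shows "linear_opr F \<Longrightarrow> linear_opr G \<Longrightarrow> linear_opr (F + G)"
    "linear_opr F \<Longrightarrow> linear_opr G \<Longrightarrow> linear_opr (F - G)"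
    "linear_opr F \<Longrightarrow> linear_opr (- F)"
    "linear_opr F \<Longrightarrow> linear_opr G \<Longrightarrow> linear_opr (F \<circ> G)"
  by (auto simp: linear_opr_def smul_add smul_diff smul_uminus)

lemma linear_opr_consts:
  "linear_opr (0 :: 'a::comm_ring_1 opr)" "linear_opr (id :: 'a::comm_ring_1 opr)"
  by (simp_all add: linear_opr_def)

lemma linear_opr_smul: "linear_opr (smul c :: 'a::comm_ring_1 opr)"
  by (simp add: linear_opr_def smul_add smul_smul mult.commute)

lemma linear_opr_sigma:
  "linear_opr (sigma_plus j :: 'a::comm_ring_1 opr)" "linear_opr (sigma_minus j :: 'a::comm_ring_1 opr)"
  by (auto simp: linear_opr_def sigma_plus_def sigma_minus_def smul_def fun_eq_iff)

typedef (overloaded) 'a linop = "{F :: 'a::comm_ring_1 opr. linear_opr F}"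
  morphisms app Linop
  using linear_opr_consts(1) by blast

lemma app_Linop: "linear_opr F \<Longrightarrow> app (Linop F) = F"
  by (simp add: Linop_inverse)

lemma linear_app [simp]: "linear_opr (app a)"
  using app[of a] by simp

lemma app_smul: "app a (smul c \<psi>) = smul c (app a \<psi>)"
  and app_plus: "app a (\<psi> + \<phi>) = app a \<psi> + app a \<phi>"
  using linear_app[of a] by (simp_all add: linear_opr_def)

instantiation linop :: (comm_ring_1) ring_1
begin

definition "0 = Linop 0"
definition "1 = Linop id"
definition "a + b = Linop (app a + app b)"
definition "a - b = Linop (app a - app b)"
definition "- a = Linop (- app a)"
definition "a * b = Linop (app a \<circ> app b)"

lemma app_simps [simp]:
  "app (0 :: 'a linop) = 0" "app (1 :: 'a linop) = id"
  "app (a + b :: 'a linop) = app a + app b" "app (a - b :: 'a linop) = app a - app b"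
  "app (- a :: 'a linop) = - app a" "app (a * b :: 'a linop) = app a \<circ> app b"
  by (simp_all add: zero_linop_def one_linop_def plus_linop_def minus_linop_def uminus_linop_def
      times_linop_def app_Linop linear_opr_ops linear_opr_consts)

lemma linop_eqI: "(\<And>\<psi>. app a \<psi> = app b \<psi>) \<Longrightarrow> a = (b :: 'a linop)"
  by (simp add: app_inject[symmetric] fun_eq_iff)

instance
proof
  show "(0 :: 'a linop) \<noteq> 1"
  proof
    assume "(0 :: 'a linop) = 1"
    then have "app (0 :: 'a linop) (\<lambda>_. 1) (\<lambda>_. 0) = app 1 (\<lambda>_. 1) (\<lambda>_. 0)" by simp
    then show False by simp
  qed
qed (auto intro!: linop_eqI simp: app_plus)

end

lemma app_comp_0: "app a \<circ> 0 = 0"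
proof
  fix \<psi>
  show "(app a \<circ> 0) \<psi> = 0 \<psi>"
    using app_smul[of a 0 0] by simp
qed

lemma app_sum: "app (\<Sum>i\<in>I. f i) \<psi> = (\<Sum>i\<in>I. app (f i) \<psi>)"
  by (induction I rule: infinite_finite_induct) auto

lemma app_prod_list: "app (prod_list (map f js)) = foldr (\<lambda>j F. app (f j) \<circ> F) js id"
  by (induction js) auto

definition scalar :: "'a::comm_ring_1 \<Rightarrow> 'a linop" where "scalar c = Linop (smul c)"
definition raise :: "nat \<Rightarrow> 'a::comm_ring_1 linop" where "raise j = Linop (sigma_plus j)"
definition lower :: "nat \<Rightarrow> 'a::comm_ring_1 linop" where "lower j = Linop (sigma_minus j)"

lemma app_generators [simp]:
  "app (scalar c) = smul c" "app (raise j) = sigma_plus j" "app (lower j) = sigma_minus j"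
  by (simp_all add: scalar_def raise_def lower_def app_Linop linear_opr_smul linear_opr_sigma)

lemma scalar_central: "scalar c * a = a * scalar c"
  by (rule linop_eqI) (simp add: app_smul)

lemma scalar_power: "scalar c ^ k = scalar (c ^ k)"
  by (induction k) (auto intro!: linop_eqI simp: smul_smul)

lemma scalar_1: "scalar 1 = 1"
  by (rule linop_eqI) simp

lemma raise_lower_commute:
  assumes "i \<noteq> j"
  shows "raise i * raise j = raise j * (raise i :: 'a::comm_ring_1 linop)"
    "lower i * lower j = lower j * (lower i :: 'a linop)"
    "raise i * lower j = lower j * (raise i :: 'a linop)"
  by (rule linop_eqI, use assms in \<open>simp add: sigma_plus_def sigma_minus_def fun_eq_iff fun_upd_twist\<close>)+

lemma raise_raise: "raise j * raise j = (0 :: 'a::comm_ring_1 linop)"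
  by (rule linop_eqI) (simp add: sigma_plus_def fun_eq_iff)

text \<open>
  Reversing all products exchanges the clockwise and the anticlockwise order, and thereby turns the results on
  \<open>site_ring\<close> for \<open>E\<close> into those for \<open>H\<close>.
\<close>

typedef 'a opposite = "UNIV :: 'a set" morphisms unopp opp
  by simp

lemma unopp_opp [simp]: "unopp (opp a) = a"
  by (simp add: opp_inverse)

lemma opposite_eq_iff: "a = b \<longleftrightarrow> unopp a = unopp b"
  by (simp add: unopp_inject)

instantiation opposite :: (ring_1) ring_1
begin

definition "0 = opp 0"
definition "1 = opp 1"
definition "a + b = opp (unopp a + unopp b)"
definition "a - b = opp (unopp a - unopp b)"
definition "- a = opp (- unopp a)"
definition "a * b = opp (unopp b * unopp a)"

lemma unopp_simps [simp]:
  "unopp (0 :: 'a opposite) = 0" "unopp (1 :: 'a opposite) = 1"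
  "unopp (a + b :: 'a opposite) = unopp a + unopp b" "unopp (a - b :: 'a opposite) = unopp a - unopp b"
  "unopp (- a :: 'a opposite) = - unopp a" "unopp (a * b :: 'a opposite) = unopp b * unopp a"
  by (simp_all add: zero_opposite_def one_opposite_def plus_opposite_def minus_opposite_def
      uminus_opposite_def times_opposite_def)

instance
  by standard (simp_all add: opposite_eq_iff algebra_simps)

end

lemma unopp_sum: "unopp (\<Sum>i\<in>I. f i) = (\<Sum>i\<in>I. unopp (f i))"
  by (induction I rule: infinite_finite_induct) auto

lemma unopp_prod_list: "unopp (prod_list (map f js)) = prod_list (map (\<lambda>j. unopp (f j)) (rev js))"
  by (induction js) auto

lemma unopp_power: "unopp (a ^ k) = unopp a ^ k"
  by (induction k) (simp_all add: power_commutes)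


section \<open>Expansion of the transfer matrices\<close>

text \<open>
  The monodromy of a chain is defined by composition of operators; the recursion of its entries may be checked
  in the ring of linear operators. The index shift avoids the empty chain, for which the closed forms of
  \<open>site_ring\<close> do not hold.
\<close>

lemma monodromy_app:
  assumes "\<And>j. L j = (app (l00 j), app (l01 j), app (l10 j), app (l11 j))"
    and "A 0 = l00 1" "B 0 = l01 1" "C 0 = l10 1" "D 0 = l11 1"
    and "\<And>k. Suc k < N \<Longrightarrow> A (Suc k) = l00 (k + 2) * A k + l01 (k + 2) * C k"
      "\<And>k. Suc k < N \<Longrightarrow> B (Suc k) = l00 (k + 2) * B k + l01 (k + 2) * D k"
      "\<And>k. Suc k < N \<Longrightarrow> C (Suc k) = l10 (k + 2) * A k + l11 (k + 2) * C k"
      "\<And>k. Suc k < N \<Longrightarrow> D (Suc k) = l10 (k + 2) * B k + l11 (k + 2) * D k"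
    and "k < N"
  shows "monodromy L (Suc k) = (app (A k), app (B k), app (C k), app (D k))"
  using \<open>k < N\<close>
proof (induction k)
  case 0
  show ?case
    by (simp add: assms(1-5) app_comp_0)
next
  case (Suc k)
  then show ?case
    by (simp add: assms(1,6-9) fun_eq_iff)
qed

text \<open>
  The operators \<open>p\<^sub>j\<close> for \<open>E\<close> and \<open>H\<close> are stated over an arbitrary coefficient ring: they are needed over the
  polynomials in \<open>x\<close>, and again after the coefficients have been extracted.
\<close>

definition local_E :: "'a::comm_ring_1 \<Rightarrow> (nat \<Rightarrow> 'a) \<Rightarrow> nat \<Rightarrow> nat \<Rightarrow> 'a opr" where
  "local_E q s N j = (smul (if j = N then q else 1) \<circ> sigma_minus j \<circ> sigma_plus (nxt N j))
     + (smul (s j) \<circ> sigma_plus j \<circ> sigma_minus j)"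

definition local_H :: "'a::comm_ring_1 \<Rightarrow> (nat \<Rightarrow> 'a) \<Rightarrow> nat \<Rightarrow> nat \<Rightarrow> 'a opr" where
  "local_H q s N j = (smul (if j = N then q else 1) \<circ> sigma_minus j \<circ> sigma_plus (nxt N j))
     - (smul (s j) \<circ> sigma_minus j \<circ> sigma_plus j)"

lemma E_trace_expansion:
  fixes x q :: "'a::comm_ring_1"
  assumes N: "2 \<le> N"
  shows "\<exists>R W. twisted_trace q (monodromy (Lax_E x s) N)
      = app ((\<Sum>(m, S)\<in>gap_data N. scalar (x ^ (N - m + card S)) * W m S) + scalar (x ^ N) * R)
    \<and> (\<forall>m S. app (W m S) = foldr (\<lambda>j F. local_E q s N j \<circ> F) (gap_word N m S) id)"
proof -
  let ?d = "\<lambda>j. scalar (s j) * (raise j * lower j)"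
  interpret site_ring "scalar x" "scalar q" raise lower ?d N
  proof
    fix a :: "'a linop" and j
    assume "a * raise j = raise j * a" "a * lower j = lower j * a"
    then show "a * ?d j = ?d j * a"
      by (intro commute_mult scalar_central[symmetric])
  next
    fix j
    have "raise j * ?d j = scalar (s j) * ((raise j * raise j) * lower j)"
      by (metis scalar_central mult.assoc)
    then show "raise j * ?d j = 0"
      by (simp add: raise_raise)
  qed (use N in \<open>simp_all add: scalar_central raise_lower_commute\<close>)
  have last: "N - 1 < N" using N by simp
  have "monodromy (Lax_E x s) (Suc (N - 1)) = (app (A (N - 1)), app (B (N - 1)), app (C (N - 1)), app (D (N - 1)))"
  proof (rule monodromy_app)
    show "Lax_E x s j = (app (1 + scalar x * ?d j), app (scalar x * raise j), app (lower j),
        app (scalar x * (raise j * lower j)))" for j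
      by (simp add: Lax_E_def fun_eq_iff smul_smul)
    show "N - 1 < N" by (rule last)
  qed (use N entries_0 entries_left in simp_all)
  then have "twisted_trace q (monodromy (Lax_E x s) N) = app (A (N - 1) + scalar q * D (N - 1))"
    using N by (simp add: twisted_trace_def)
  moreover have "app (p j) = local_E q s N j" for j
    by (simp add: p_def local_E_def fun_eq_iff)
  moreover obtain R where "A (N - 1) + scalar q * D (N - 1)
      = (\<Sum>(m, S)\<in>gap_data N. scalar (x ^ (N - m + card S)) * prod_list (map p (gap_word N m S)))
        + scalar (x ^ N) * R"
    using trace_expansion unfolding scalar_power by blast
  ultimately show ?thesis
    by (intro exI[of _ R] exI[of _ "\<lambda>m S. prod_list (map p (gap_word N m S))"])
       (simp only: app_prod_list simp_thms)
qed

text \<open>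
  In the opposite ring the diagonal term satisfies \<open>sp_d\<close> because \<open>d\<^sub>j \<sigma>\<^sup>+\<^sub>j = 0\<close>, and the lower right
  entry of the Lax matrix is the product of \<open>\<sigma>\<^sup>+\<^sub>j\<close> and \<open>\<sigma>\<^sup>-\<^sub>j\<close> as for \<open>E\<close>.
\<close>

lemma H_trace_expansion:
  fixes x q :: "'a::comm_ring_1"
  assumes N: "2 \<le> N"
  shows "\<exists>R W. twisted_trace q (monodromy (Lax_H x s) N)
      = app ((\<Sum>(m, S)\<in>gap_data N. scalar (x ^ (N - m + card S)) * W m S) + scalar (x ^ N) * R)
    \<and> (\<forall>m S. app (W m S) = foldr (\<lambda>j F. local_H q s N j \<circ> F) (rev (gap_word N m S)) id)"
proof -
  let ?d = "\<lambda>j. opp (- (scalar (s j) * (lower j * raise j)))"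
  interpret site_ring "opp (scalar x)" "opp (scalar q)" "\<lambda>j. opp (raise j)" "\<lambda>j. opp (lower j)" ?d N
  proof
    fix a :: "'a linop opposite" and j
    assume "a * opp (raise j) = opp (raise j) * a" "a * opp (lower j) = opp (lower j) * a"
    then have "unopp a * raise j = raise j * unopp a" "unopp a * lower j = lower j * unopp a"
      by (simp_all add: opposite_eq_iff)
    then have "unopp a * (scalar (s j) * (lower j * raise j)) = scalar (s j) * (lower j * raise j) * unopp a"
      by (intro commute_mult scalar_central[symmetric])
    then show "a * ?d j = ?d j * a"
      by (simp add: opposite_eq_iff)
  next
    fix j
    have "scalar (s j) * (lower j * raise j) * raise j = scalar (s j) * (lower j * (raise j * raise j))"
      by (simp only: mult.assoc)
    then show "opp (raise j) * ?d j = 0"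
      by (simp add: opposite_eq_iff raise_raise)
  qed (use N in \<open>simp_all add: opposite_eq_iff scalar_central raise_lower_commute\<close>)
  have x: "scalar x * a = a * scalar x" for a :: "'a linop" by (rule scalar_central)
  have last: "N - 1 < N" using N by simp
  have "monodromy (Lax_H x s) (Suc (N - 1))
      = (app (unopp (A (N - 1))), app (unopp (B (N - 1))), app (unopp (C (N - 1))), app (unopp (D (N - 1))))"
  proof (rule monodromy_app)
    show "Lax_H x s j = (app (1 + unopp (?d j) * scalar x), app (raise j * scalar x), app (lower j),
        app (lower j * raise j * scalar x))" for j
      by (simp add: x[symmetric]) (simp add: Lax_H_def fun_eq_iff smul_smul)
    show "N - 1 < N" by (rule last)
  qed (use N entries_0 A_right B_right C_right D_right in \<open>simp_all add: opposite_eq_iff\<close>)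
  then have "twisted_trace q (monodromy (Lax_H x s) N) = app (unopp (A (N - 1) + opp (scalar q) * D (N - 1)))"
    using N scalar_central[of q] by (simp add: twisted_trace_def fun_eq_iff app_smul)
  moreover have "app (unopp (p j)) = local_H q s N j" for j
  proof -
    have "unopp (p j) = scalar (if j = N then q else 1) * (lower j * raise (nxt N j))
        - scalar (s j) * (lower j * raise j)"
      using raise_lower_commute(3)[of "nxt N j" j] nxt_neq[OF N, of j] scalar_central[of q]
      by (cases "j = N") (simp_all add: p_def scalar_1)
    then show ?thesis
      by (simp add: local_H_def fun_eq_iff)
  qed
  moreover obtain R where "A (N - 1) + opp (scalar q) * D (N - 1)
      = (\<Sum>(m, S)\<in>gap_data N. opp (scalar x) ^ (N - m + card S) * prod_list (map p (gap_word N m S)))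
        + opp (scalar x) ^ N * R"
    using trace_expansion by blast
  then have "unopp (A (N - 1) + opp (scalar q) * D (N - 1))
      = (\<Sum>(m, S)\<in>gap_data N. scalar (x ^ (N - m + card S)) * unopp (prod_list (map p (gap_word N m S))))
        + scalar (x ^ N) * unopp R"
    by (simp add: unopp_sum unopp_power scalar_power scalar_central[symmetric] split_def)
  ultimately show ?thesis
    by (intro exI[of _ "unopp R"] exI[of _ "\<lambda>m S. unopp (prod_list (map p (gap_word N m S)))"])
       (simp only: app_prod_list unopp_prod_list simp_thms)
qed


section \<open>The representation of the affine nil-Hecke algebra\<close>

definition hop_coeff :: "nat \<Rightarrow> nat \<Rightarrow> laurent poly" where
  "hop_coeff N j = [:tinv N j:] * (if j = N then qvar else 1)"

text \<open>
  The operators of the representation act on functions of configurations, so the particle moves backwards when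
  the value at \<open>\<epsilon>\<close> is read off. All relations between them can be checked with this formula, also at
  configurations with values other than \<open>0\<close> and \<open>1\<close>.
\<close>

lemma rho_gen_apply:
  assumes "2 \<le> N"
  shows "rho_gen N j \<psi> \<epsilon> = (if \<epsilon> j = 0 then
      (if \<epsilon> (nxt N j) = 1
       then hop_coeff N j * \<psi> (\<epsilon>(nxt N j := 0, j := 1)) else 0) - \<psi> \<epsilon>
     else 0)"
  using nxt_neq[OF assms, of j]
  by (simp add: rho_gen_def hop_coeff_def smul_def sigma_minus_def sigma_plus_def fun_upd_twist fun_upd_idem)

definition pi_op :: "nat \<Rightarrow> nat \<Rightarrow> laurent poly linop" where
  "pi_op N j = Linop (rho_gen N j)"

lemma app_pi_op [simp]: "app (pi_op N j) = rho_gen N j"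
  unfolding pi_op_def rho_gen_def
  by (intro app_Linop linear_opr_ops linear_opr_smul linear_opr_sigma)

lemma pi_op_quadratic:
  assumes "2 \<le> N"
  shows "pi_op N j * pi_op N j + pi_op N j = 0"
  using nxt_neq[OF assms, of j]
  by (intro linop_eqI) (simp add: fun_eq_iff rho_gen_apply[OF assms])

lemma nxt_inj:
  assumes "i \<in> {1..N}" "j \<in> {1..N}" "nxt N i = nxt N j"
  shows "i = j"
  using assms by (cases "i = N"; cases "j = N") (auto simp: nxt_def)

lemma pi_op_comm:
  assumes N: "2 \<le> N" and ij: "i \<in> {1..N}" "j \<in> {1..N}" "i \<noteq> nxt N j" "j \<noteq> nxt N i"
  shows "pi_op N i * pi_op N j = pi_op N j * pi_op N i"
proof (cases "i = j")
  case False
  then have "nxt N i \<noteq> nxt N j"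
    using nxt_inj ij(1,2) by blast
  then show ?thesis
    using False ij(3,4) nxt_neq[OF N, of i] nxt_neq[OF N, of j]
    by (intro linop_eqI) (simp add: fun_eq_iff rho_gen_apply[OF N] fun_upd_twist algebra_simps)
qed simp

lemma pi_op_braid:
  assumes N: "3 \<le> N" and i: "i \<in> {1..N}"
  shows "pi_op N i * pi_op N (nxt N i) * pi_op N i = pi_op N (nxt N i) * pi_op N i * pi_op N (nxt N i)"
proof -
  have N2: "2 \<le> N" using N by simp
  define k l where "k = nxt N i" and "l = nxt N k"
  have "k \<noteq> i" "l \<noteq> k"
    unfolding l_def k_def by (rule nxt_neq[OF N2])+
  moreover have "l \<noteq> i"
    using N i by (cases "i = N"; cases "i + 1 = N") (auto simp: l_def k_def nxt_def)
  ultimately have distinct: "k \<noteq> i" "l \<noteq> k" "l \<noteq> i" "i \<noteq> k" "k \<noteq> l" "i \<noteq> l"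
    by auto
  have "(rho_gen N i (rho_gen N k (rho_gen N i \<psi>))) \<epsilon> = (rho_gen N k (rho_gen N i (rho_gen N k \<psi>))) \<epsilon>" for \<psi> \<epsilon>
  proof -
    define a b where "a = hop_coeff N i" and "b = hop_coeff N k"
    have act: "rho_gen N i \<psi> \<epsilon>
        = (if \<epsilon> i = 0 then (if \<epsilon> k = 1 then a * \<psi> (\<epsilon>(k := 0, i := 1)) else 0) - \<psi> \<epsilon> else 0)"
      "rho_gen N k \<psi> \<epsilon>
        = (if \<epsilon> k = 0 then (if \<epsilon> l = 1 then b * \<psi> (\<epsilon>(l := 0, k := 1)) else 0) - \<psi> \<epsilon> else 0)" for \<psi> \<epsilon>
      by (simp_all add: rho_gen_apply[OF N2] a_def b_def k_def l_def)
    show ?thesis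
      unfolding act using distinct
      by (cases "\<epsilon> i = 0"; cases "\<epsilon> k = 0"; cases "\<epsilon> k = 1"; cases "\<epsilon> l = 1")
        (simp_all add: algebra_simps fun_upd_twist[of i k] fun_upd_twist[of i l] fun_upd_twist[of k l])
  qed
  then show ?thesis
    unfolding k_def[symmetric] by (intro linop_eqI) (simp add: fun_eq_iff)
qed

definition word_op :: "nat \<Rightarrow> word \<Rightarrow> laurent poly linop" where
  "word_op N u = prod_list (map (pi_op N) (letters u))"

lemma word_op_simps [simp]:
  "word_op N 0 = 1" "word_op N (u + v) = word_op N u * word_op N v"
  by (simp_all add: word_op_def zero_word_def plus_word_def)

definition free_op :: "nat \<Rightarrow> (word \<Rightarrow>\<^sub>0 int) \<Rightarrow> laurent poly linop" where
  "free_op N f = (\<Sum>u\<in>Poly_Mapping.keys f. of_int (Poly_Mapping.lookup f u) * word_op N u)"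

lemma of_int_linop: "app (of_int k :: 'a::comm_ring_1 linop) = smul (of_int k)"
proof -
  have "(of_int k :: 'a linop) = scalar (of_int k)"
  proof (induction k rule: int_induct[where k = 0])
    case base
    show ?case by (rule linop_eqI) simp
  next
    case (step1 i)
    then show ?case by (intro linop_eqI) (simp add: smul_def fun_eq_iff algebra_simps)
  next
    case (step2 i)
    then show ?case by (intro linop_eqI) (simp add: smul_def fun_eq_iff algebra_simps)
  qed
  then show ?thesis by simp
qed

lemma rho_free_eq_app: "rho_free N f = app (free_op N f)"
proof
  fix \<psi>
  have "sum F A \<psi> = (\<Sum>u\<in>A. F u \<psi>)" for F :: "word \<Rightarrow> laurent poly opr" and A
    by (induction A rule: infinite_finite_induct) auto
  then show "rho_free N f \<psi> = app (free_op N f) \<psi>"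
    by (simp add: rho_free_def free_op_def app_sum of_int_linop word_op_def app_prod_list)
qed

lemma free_op_0 [simp]: "free_op N 0 = 0"
  by (simp add: free_op_def)

lemma free_op_single [simp]: "free_op N (Poly_Mapping.single u c) = of_int c * word_op N u"
  by (cases "c = 0") (simp_all add: free_op_def)

lemma free_op_add [simp]: "free_op N (f + g) = free_op N f + free_op N g"
  unfolding free_op_def
  by (rule setsum_keys_plus_distrib[where f = "\<lambda>u c. of_int c * word_op N u"])
     (simp_all add: distrib_right)

lemma free_op_diff [simp]: "free_op N (f - g) = free_op N f - free_op N g"
  using free_op_add[of N "f - g" g] by (simp add: algebra_simps)

text \<open>
  Bilinear identities in a monoid ring need to be checked only for monomials.
\<close>

lemma poly_mapping_additive_induct [case_names zero single add]:
  assumes "P 0" "\<And>u c. P (Poly_Mapping.single u c)" "\<And>f g. P f \<Longrightarrow> P g \<Longrightarrow> P (f + g)"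
  shows "P (f :: 'a \<Rightarrow>\<^sub>0 'b::monoid_add)"
proof (induction f rule: update_induct)
  case (update f a b)
  have "Poly_Mapping.update a b f = f + Poly_Mapping.single a b"
    using update(1) by (intro poly_mapping_eqI) (auto simp: lookup_update lookup_add lookup_single in_keys_iff)
  then show ?case
    using assms update by simp
qed (rule assms)

lemma free_op_mult [simp]: "free_op N (f * g) = free_op N f * free_op N g"
proof (induction f rule: poly_mapping_additive_induct)
  case (single u c)
  show ?case
  proof (induction g rule: poly_mapping_additive_induct)
    case (single v d)
    have "of_int c * word_op N u * (of_int d * word_op N v) = of_int c * (word_op N u * of_int d) * word_op N v"
      by (simp only: mult.assoc)
    also have "\<dots> = of_int (c * d) * (word_op N u * word_op N v)"
      by (simp only: mult_of_int_commute[of d "word_op N u", symmetric] of_int_mult mult.assoc)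
    finally show ?case by (simp only: mult_single free_op_single word_op_simps)
  qed (simp_all add: algebra_simps)
qed (simp_all add: algebra_simps)

lemma free_op_1 [simp]: "free_op N 1 = 1"
  by (simp flip: single_one)

lemma free_op_gen [simp]: "free_op N (gen j) = pi_op N j"
  by (simp add: gen_def word_op_def)

lemma free_op_prod_list: "free_op N (prod_list fs) = prod_list (map (free_op N) fs)"
  by (induction fs) auto

lemma free_ring_simps [simp]:
  "mult (free_ring N) = (*)" "one (free_ring N) = 1" "zero (free_ring N) = 0" "add (free_ring N) = (+)"
  by (simp_all add: free_ring_def)

lemma free_ring_closed:
  "0 \<in> carrier (free_ring N)" "1 \<in> carrier (free_ring N)"
  "f \<in> carrier (free_ring N) \<Longrightarrow> - f \<in> carrier (free_ring N)"
  "\<lbrakk>f \<in> carrier (free_ring N); g \<in> carrier (free_ring N)\<rbrakk> \<Longrightarrow> f + g \<in> carrier (free_ring N)"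
  "\<lbrakk>f \<in> carrier (free_ring N); g \<in> carrier (free_ring N)\<rbrakk> \<Longrightarrow> f - g \<in> carrier (free_ring N)"
  "\<lbrakk>f \<in> carrier (free_ring N); g \<in> carrier (free_ring N)\<rbrakk> \<Longrightarrow> f * g \<in> carrier (free_ring N)"
  "j \<in> {1..N} \<Longrightarrow> gen j \<in> carrier (free_ring N)"
proof -
  show add: "\<lbrakk>f \<in> carrier (free_ring N); g \<in> carrier (free_ring N)\<rbrakk> \<Longrightarrow> f + g \<in> carrier (free_ring N)" for f g
    using keys_add[of f g] by (auto simp: free_ring_def)
  show minus: "f \<in> carrier (free_ring N) \<Longrightarrow> - f \<in> carrier (free_ring N)" for f
    by (simp add: free_ring_def in_keys_iff)
  show "\<lbrakk>f \<in> carrier (free_ring N); g \<in> carrier (free_ring N)\<rbrakk> \<Longrightarrow> f - g \<in> carrier (free_ring N)"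
    using add[OF _ minus, of f g] by simp
  show "\<lbrakk>f \<in> carrier (free_ring N); g \<in> carrier (free_ring N)\<rbrakk> \<Longrightarrow> f * g \<in> carrier (free_ring N)"
    using keys_mult[of f g] by (fastforce simp: free_ring_def plus_word_def)
qed (simp_all add: free_ring_def gen_def zero_word_def)

lemma free_ring_prod_list_closed:
  "set fs \<subseteq> carrier (free_ring N) \<Longrightarrow> prod_list fs \<in> carrier (free_ring N)"
  by (induction fs) (auto intro: free_ring_closed)

lemma ring_free_ring: "ring (free_ring N)"
proof (rule ringI)
  show "abelian_group (free_ring N)"
  proof (rule abelian_groupI)
    fix f assume "f \<in> carrier (free_ring N)"
    then show "\<exists>g\<in>carrier (free_ring N). g \<oplus>\<^bsub>free_ring N\<^esub> f = \<zero>\<^bsub>free_ring N\<^esub>"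
      by (intro bexI[of _ "- f"]) (auto intro: free_ring_closed)
  qed (auto simp: add_ac intro: free_ring_closed)
  show "Group.monoid (free_ring N)"
    by (rule Group.monoidI) (auto simp: mult.assoc intro: free_ring_closed)
qed (auto simp: algebra_simps)

lemma nil_Hecke_relators_closed: "nil_Hecke_relators N \<subseteq> carrier (free_ring N)"
proof (cases "N = 0")
  case False
  then show ?thesis
    using nxt_letter[of N] by (auto simp: nil_Hecke_relators_def intro!: free_ring_closed)
qed (auto simp: nil_Hecke_relators_def)

lemma ideal_nil_Hecke: "ideal (nil_Hecke_ideal N) (free_ring N)"
  unfolding nil_Hecke_ideal_def
  by (rule ring.genideal_ideal[OF ring_free_ring nil_Hecke_relators_closed])

text \<open>
  The kernel of the evaluation is an ideal that contains the defining relations. Hence the evaluation is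
  constant on residue classes.
\<close>

lemma free_op_nil_Hecke_ideal:
  assumes N: "2 \<le> N" and f: "f \<in> nil_Hecke_ideal N"
  shows "free_op N f = 0"
proof -
  let ?K = "{f \<in> carrier (free_ring N). free_op N f = 0}"
  interpret ring "free_ring N" by (rule ring_free_ring)
  have inv: "inv\<^bsub>add_monoid (free_ring N)\<^esub> f = - f" if "f \<in> carrier (free_ring N)" for f
    using minus_equality[of "- f" f] that free_ring_closed(3)[OF that] by (simp add: a_inv_def)
  have "ideal ?K (free_ring N)"
  proof (rule idealI[OF ring_free_ring])
    show "subgroup ?K (add_monoid (free_ring N))"
    proof (rule subgroup.intro)
      fix f assume f: "f \<in> ?K"
      then have "free_op N (- f) = 0"
        using free_op_diff[of N 0 f] by simp
      then show "inv\<^bsub>add_monoid (free_ring N)\<^esub> f \<in> ?K"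
        using f inv free_ring_closed(3)[of f N] by auto
    qed (auto intro: free_ring_closed)
  qed (auto intro: free_ring_closed)
  moreover have "nil_Hecke_relators N \<subseteq> ?K"
  proof
    fix f assume f: "f \<in> nil_Hecke_relators N"
    have "free_op N f = 0"
      using f pi_op_quadratic[OF N] pi_op_braid pi_op_comm[OF N]
      by (auto simp: nil_Hecke_relators_def)
    then show "f \<in> ?K"
      using f nil_Hecke_relators_closed by auto
  qed
  ultimately have "nil_Hecke_ideal N \<subseteq> ?K"
    unfolding nil_Hecke_ideal_def by (rule genideal_minimal)
  then show ?thesis using f by auto
qed

lemma rho_coset:
  assumes "2 \<le> N"
  shows "rho N (nil_Hecke_ideal N +>\<^bsub>free_ring N\<^esub> f) = app (free_op N f)"
proof -
  interpret ideal "nil_Hecke_ideal N" "free_ring N" by (rule ideal_nil_Hecke)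
  have "0 \<in> nil_Hecke_ideal N" using zero_closed additive_subgroup.zero_closed[OF is_additive_subgroup] by simp
  then have "rho_free N ` (nil_Hecke_ideal N +>\<^bsub>free_ring N\<^esub> f) = {app (free_op N f)}"
    by (auto simp: a_r_coset_def' rho_free_eq_app free_op_nil_Hecke_ideal[OF assms] image_iff
        simp del: app_simps intro!: bexI[of _ 0])
  then show ?thesis
    by (simp add: rho_def)
qed

lemma nH_prod_cosets:
  assumes "set fs \<subseteq> carrier (free_ring N)"
  shows "nH_prod N (map (\<lambda>f. nil_Hecke_ideal N +>\<^bsub>free_ring N\<^esub> f) fs)
    = nil_Hecke_ideal N +>\<^bsub>free_ring N\<^esub> prod_list fs"
  using assms
proof (induction fs)
  case Nil
  show ?case by (simp add: nH_prod_def nil_Hecke_def FactRing_def)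
next
  case (Cons f fs)
  interpret ideal "nil_Hecke_ideal N" "free_ring N" by (rule ideal_nil_Hecke)
  show ?case
    using Cons free_ring_prod_list_closed[of fs N]
    by (simp add: nH_prod_def nil_Hecke_def FactRing_def rcoset_mult_add)
qed

lemma rho_nH_prod:
  assumes "2 \<le> N" "set fs \<subseteq> carrier (free_ring N)"
  shows "rho N (nH_prod N (map (\<lambda>f. nil_Hecke_ideal N +>\<^bsub>free_ring N\<^esub> f) fs))
    = app (prod_list (map (free_op N) fs))"
  by (simp only: nH_prod_cosets[OF assms(2)] rho_coset[OF assms(1)] free_op_prod_list)

lemma rho_word_pi:
  assumes "2 \<le> N" "set js \<subseteq> {1..N}"
  shows "rho N (nH_prod N (map (nH_pi N) js)) = foldr (\<lambda>j F. rho_gen N j \<circ> F) js id"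
proof -
  have "map (nH_pi N) js = map (\<lambda>f. nil_Hecke_ideal N +>\<^bsub>free_ring N\<^esub> f) (map gen js)"
    by (simp add: nH_pi_def)
  moreover have "set (map gen js) \<subseteq> carrier (free_ring N)"
    using assms(2) free_ring_closed(7) by auto
  ultimately have "rho N (nH_prod N (map (nH_pi N) js)) = app (prod_list (map (free_op N) (map gen js)))"
    by (simp only: rho_nH_prod[OF assms(1)])
  also have "map (free_op N) (map gen js) = map (pi_op N) js"
    by simp
  finally show ?thesis
    by (simp only: app_prod_list app_pi_op)
qed

lemma rho_word_pibar:
  assumes "2 \<le> N" "set js \<subseteq> {1..N}"
  shows "rho N (nH_prod N (map (nH_pibar N) js)) = foldr (\<lambda>j F. (rho_gen N j + id) \<circ> F) js id"
proof -
  interpret ideal "nil_Hecke_ideal N" "free_ring N" by (rule ideal_nil_Hecke)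
  have "nH_pibar N j = nil_Hecke_ideal N +>\<^bsub>free_ring N\<^esub> (gen j + 1)" if "j \<in> {1..N}" for j
    using a_rcos_sum[OF free_ring_closed(7)[OF that] free_ring_closed(2)]
    by (simp add: nH_pibar_def nH_pi_def nil_Hecke_def FactRing_def)
  then have "map (nH_pibar N) js = map (\<lambda>f. nil_Hecke_ideal N +>\<^bsub>free_ring N\<^esub> f) (map (\<lambda>j. gen j + 1) js)"
    using assms(2) by auto
  moreover have "set (map (\<lambda>j. gen j + 1) js) \<subseteq> carrier (free_ring N)"
    using assms(2) by (auto intro!: free_ring_closed)
  ultimately have "rho N (nH_prod N (map (nH_pibar N) js)) = app (prod_list (map (free_op N) (map (\<lambda>j. gen j + 1) js)))"
    by (simp only: rho_nH_prod[OF assms(1)])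
  also have "map (free_op N) (map (\<lambda>j. gen j + 1) js) = map (\<lambda>j. pi_op N j + 1) js"
    by simp
  finally show ?thesis
    by (simp only: app_prod_list app_pi_op app_simps)
qed


section \<open>Coefficients of the transfer matrices\<close>

lemma sum_fun_apply: "(\<Sum>d\<in>A. f d) \<epsilon> = (\<Sum>d\<in>A. f d \<epsilon>)"
  for f :: "'d \<Rightarrow> 'c \<Rightarrow> 'b::comm_monoid_add"
  by (induction A rule: infinite_finite_induct) auto

lemma coeff_X_power_mult: "coeff ([:0, 1:] ^ k * p) r = (if r < k then 0 else coeff p (r - k))"
  for p :: "'a::comm_ring_1 poly"
  using coeff_monom_mult[of 1 k p r] by (simp add: monom_altdef)

lemma coeff_X_power_mult_const: "coeff ([:0, 1:] ^ k * [:c:]) r = (if k = r then c else 0)"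
  for c :: "'a::comm_ring_1"
  unfolding coeff_X_power_mult by (auto simp: coeff_pCons split: nat.splits)

text \<open>
  The remainder is divisible by \<open>x\<^sup>N\<close> and so does not contribute below degree \<open>N\<close>; the operators \<open>W d\<close> do not
  involve \<open>x\<close>, so each summand contributes to a single degree.
\<close>

lemma opr_coeff_expansion:
  fixes W :: "'d \<Rightarrow> 'a::comm_ring_1 poly linop"
  assumes "finite I"
    and F: "F = app ((\<Sum>d\<in>I. scalar ([:0, 1:] ^ e d) * W d) + scalar ([:0, 1:] ^ N) * R)"
    and W: "\<And>d. d \<in> I \<Longrightarrow> app (W d) (\<lambda>\<eta>. [:\<psi> \<eta>:]) = (\<lambda>\<eta>. [:w d \<eta>:])"
    and "r < N"
  shows "opr_coeff r F \<psi> = (\<Sum>d\<in>{d \<in> I. e d = r}. w d)"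
proof
  fix \<epsilon>
  let ?\<psi> = "\<lambda>\<eta>. [:\<psi> \<eta>:]"
  have "opr_coeff r F \<psi> \<epsilon> = (\<Sum>d\<in>I. coeff ([:0, 1:] ^ e d * app (W d) ?\<psi> \<epsilon>) r)
      + coeff ([:0, 1:] ^ N * app R ?\<psi> \<epsilon>) r"
    unfolding opr_coeff_def F
    by (simp add: app_sum sum_fun_apply smul_def coeff_sum)
  also have "\<dots> = (\<Sum>d\<in>I. if e d = r then w d \<epsilon> else 0)"
  proof -
    have "coeff ([:0, 1:] ^ e d * app (W d) ?\<psi> \<epsilon>) r = (if e d = r then w d \<epsilon> else 0)" if "d \<in> I" for d
      by (simp only: W[OF that] coeff_X_power_mult_const)
    then show ?thesis
      using \<open>r < N\<close> by (simp add: coeff_X_power_mult[of N])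
  qed
  also have "\<dots> = (\<Sum>d\<in>{d \<in> I. e d = r}. w d) \<epsilon>"
    unfolding sum_fun_apply by (rule sum.inter_filter[OF assms(1), symmetric])
  finally show "opr_coeff r F \<psi> \<epsilon> = (\<Sum>d\<in>{d \<in> I. e d = r}. w d) \<epsilon>" .
qed

lemma local_const:
  "local_E [:q:] (\<lambda>j. [:s j:]) N j (\<lambda>\<eta>. [:\<psi> \<eta>:]) = (\<lambda>\<eta>. [:local_E q s N j \<psi> \<eta>:])"
  "local_H [:q:] (\<lambda>j. [:s j:]) N j (\<lambda>\<eta>. [:\<psi> \<eta>:]) = (\<lambda>\<eta>. [:local_H q s N j \<psi> \<eta>:])"
  by (auto simp: local_E_def local_H_def smul_def sigma_plus_def sigma_minus_def fun_eq_iff)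

lemma foldr_local_E_const:
  "foldr (\<lambda>j F. local_E [:q:] (\<lambda>j. [:s j:]) N j \<circ> F) js id (\<lambda>\<eta>. [:\<psi> \<eta>:])
    = (\<lambda>\<eta>. [:foldr (\<lambda>j F. local_E q s N j \<circ> F) js id \<psi> \<eta>:])"
  by (induction js) (simp_all add: local_const)

lemma foldr_local_H_const:
  "foldr (\<lambda>j F. local_H [:q:] (\<lambda>j. [:s j:]) N j \<circ> F) js id (\<lambda>\<eta>. [:\<psi> \<eta>:])
    = (\<lambda>\<eta>. [:foldr (\<lambda>j F. local_H q s N j \<circ> F) js id \<psi> \<eta>:])"
  by (induction js) (simp_all add: local_const)

lemma E_coeff:
  assumes "2 \<le> N" "r < N"
  shows "E N r \<psi> = (\<Sum>(m, S)\<in>{(m, S) \<in> gap_data N. N - m + card S = r}.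
    foldr (\<lambda>j F. local_E qvar (\<lambda>j. [:t N j:]) N j \<circ> F) (gap_word N m S) id \<psi>)"
proof -
  obtain R W where "E_transfer N
      = app ((\<Sum>(m, S)\<in>gap_data N. scalar ([:0, 1:] ^ (N - m + card S)) * W m S) + scalar ([:0, 1:] ^ N) * R)"
    and W: "app (W m S) = foldr (\<lambda>j F. local_E [:qvar:] (\<lambda>j. [:[:t N j:]:]) N j \<circ> F) (gap_word N m S) id" for m S
    unfolding E_transfer_def using E_trace_expansion[OF assms(1)] by blast
  then have tr: "E_transfer N = app ((\<Sum>d\<in>gap_data N. scalar ([:0, 1:] ^ (case d of (m, S) \<Rightarrow> N - m + card S))
      * (case d of (m, S) \<Rightarrow> W m S)) + scalar ([:0, 1:] ^ N) * R)"
    by (simp add: split_def)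
  have "opr_coeff r (E_transfer N) \<psi> = (\<Sum>d\<in>{d \<in> gap_data N. (case d of (m, S) \<Rightarrow> N - m + card S) = r}.
      case d of (m, S) \<Rightarrow> foldr (\<lambda>j F. local_E qvar (\<lambda>j. [:t N j:]) N j \<circ> F) (gap_word N m S) id \<psi>)"
    by (rule opr_coeff_expansion[OF gap_data_finite tr _ assms(2)])
       (simp add: W foldr_local_E_const split_def)
  then show ?thesis
    by (simp add: E_def split_def)
qed

lemma H_coeff:
  assumes "2 \<le> N" "r < N"
  shows "H N r \<psi> = (\<Sum>(m, S)\<in>{(m, S) \<in> gap_data N. N - m + card S = r}.
    foldr (\<lambda>j F. local_H qvar (\<lambda>j. [:t N j:]) N j \<circ> F) (rev (gap_word N m S)) id \<psi>)"
proof -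
  obtain R W where "H_transfer N
      = app ((\<Sum>(m, S)\<in>gap_data N. scalar ([:0, 1:] ^ (N - m + card S)) * W m S) + scalar ([:0, 1:] ^ N) * R)"
    and W: "app (W m S) = foldr (\<lambda>j F. local_H [:qvar:] (\<lambda>j. [:[:t N j:]:]) N j \<circ> F) (rev (gap_word N m S)) id" for m S
    unfolding H_transfer_def using H_trace_expansion[OF assms(1)] by blast
  then have tr: "H_transfer N = app ((\<Sum>d\<in>gap_data N. scalar ([:0, 1:] ^ (case d of (m, S) \<Rightarrow> N - m + card S))
      * (case d of (m, S) \<Rightarrow> W m S)) + scalar ([:0, 1:] ^ N) * R)"
    by (simp add: split_def)
  have "opr_coeff r (H_transfer N) \<psi> = (\<Sum>d\<in>{d \<in> gap_data N. (case d of (m, S) \<Rightarrow> N - m + card S) = r}.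
      case d of (m, S) \<Rightarrow> foldr (\<lambda>j F. local_H qvar (\<lambda>j. [:t N j:]) N j \<circ> F) (rev (gap_word N m S)) id \<psi>)"
    by (rule opr_coeff_expansion[OF gap_data_finite tr _ assms(2)])
       (simp add: W foldr_local_H_const split_def)
  then show ?thesis
    by (simp add: H_def split_def)
qed


section \<open>Comparison with the nil-Hecke representation\<close>

definition weighted_pibar :: "nat \<Rightarrow> nat \<Rightarrow> laurent poly linop" where
  "weighted_pibar N j = scalar [:t N j:] * (pi_op N j + 1)"

definition weighted_pi :: "nat \<Rightarrow> nat \<Rightarrow> laurent poly linop" where
  "weighted_pi N j = scalar [:t N j:] * pi_op N j"

lemma t_hop_coeff: "[:t N j:] * hop_coeff N j = (if j = N then qvar else 1)"
proof -
  have "[:t N j:] * [:tinv N j:] = 1"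
    using T_Tinv[of "N + 1 - j"] by (simp add: t_def tinv_def one_pCons mult.commute)
  then show ?thesis
    by (simp only: hop_coeff_def mult.assoc[symmetric] mult_1_left)
qed

text \<open>
  The number operator \<open>\<sigma>\<^sup>+\<^sub>j \<sigma>\<^sup>-\<^sub>j\<close> equals \<open>1 - \<sigma>\<^sup>-\<^sub>j \<sigma>\<^sup>+\<^sub>j\<close> only where \<open>\<epsilon> j\<close> is \<open>0\<close> or \<open>1\<close>. The comparison of \<open>E\<close> with
  the operators \<open>\<rho>(\<pi>\<bar>\<^sub>j)\<close> therefore takes place on vectors with this property, which the operators preserve.
\<close>

definition binary_support :: "nat \<Rightarrow> 'a::zero vec \<Rightarrow> bool" where
  "binary_support N \<psi> \<longleftrightarrow> (\<forall>\<epsilon>. \<psi> \<epsilon> \<noteq> 0 \<longrightarrow> (\<forall>j\<in>{1..N}. \<epsilon> j \<in> {0, 1}))"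

lemma hop_pair_apply:
  assumes "2 \<le> N"
  shows "sigma_minus j (sigma_plus (nxt N j) \<psi>) \<epsilon>
    = (if \<epsilon> j = 0 \<and> \<epsilon> (nxt N j) = 1 then \<psi> (\<epsilon>(nxt N j := 0, j := 1)) else 0)"
  using nxt_neq[OF assms, of j] by (simp add: sigma_minus_def sigma_plus_def fun_upd_twist)

lemma weighted_pi_eq_local_H:
  assumes "2 \<le> N"
  shows "app (weighted_pi N j) = local_H qvar (\<lambda>j. [:t N j:]) N j"
proof (intro ext)
  fix \<psi> \<epsilon>
  have "app (weighted_pi N j) \<psi> \<epsilon> = [:t N j:] * rho_gen N j \<psi> \<epsilon>"
    by (simp add: weighted_pi_def smul_def)
  also have "\<dots> = (if \<epsilon> j = 0 then (if \<epsilon> (nxt N j) = 1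
      then [:t N j:] * hop_coeff N j * \<psi> (\<epsilon>(nxt N j := 0, j := 1)) else 0) - [:t N j:] * \<psi> \<epsilon> else 0)"
    unfolding rho_gen_apply[OF assms] by (simp only: if_distrib[of "(*) _"] right_diff_distrib mult_zero_right mult.assoc)
  also have "\<dots> = local_H qvar (\<lambda>j. [:t N j:]) N j \<psi> \<epsilon>"
    unfolding t_hop_coeff
    by (simp add: local_H_def smul_def hop_pair_apply[OF assms]) (simp add: sigma_minus_def sigma_plus_def fun_upd_idem)
  finally show "app (weighted_pi N j) \<psi> \<epsilon> = local_H qvar (\<lambda>j. [:t N j:]) N j \<psi> \<epsilon>" .
qed

lemma weighted_pibar_eq_local_E:
  assumes "2 \<le> N" "j \<in> {1..N}" "binary_support N \<psi>"
  shows "app (weighted_pibar N j) \<psi> = local_E qvar (\<lambda>j. [:t N j:]) N j \<psi>"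
proof
  fix \<epsilon>
  have zero: "\<psi> \<epsilon> = 0" if "\<epsilon> j \<noteq> 0" "\<epsilon> j \<noteq> 1"
    using assms(3)[unfolded binary_support_def, rule_format, of \<epsilon> j] assms(2) that by force
  have "app (weighted_pibar N j) \<psi> \<epsilon> = [:t N j:] * (rho_gen N j \<psi> \<epsilon> + \<psi> \<epsilon>)"
    by (simp add: weighted_pibar_def smul_def)
  also have "\<dots> = (if \<epsilon> j = 0 then (if \<epsilon> (nxt N j) = 1
      then [:t N j:] * hop_coeff N j * \<psi> (\<epsilon>(nxt N j := 0, j := 1)) else 0) else [:t N j:] * \<psi> \<epsilon>)"
    unfolding rho_gen_apply[OF assms(1)] by (simp only: mult.assoc) simp
  also have "\<dots> = local_E qvar (\<lambda>j. [:t N j:]) N j \<psi> \<epsilon>"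
    unfolding t_hop_coeff
    using zero by (simp add: local_E_def smul_def hop_pair_apply[OF assms(1)])
       (auto simp: sigma_minus_def sigma_plus_def fun_upd_idem)
  finally show "app (weighted_pibar N j) \<psi> \<epsilon> = local_E qvar (\<lambda>j. [:t N j:]) N j \<psi> \<epsilon>" .
qed

lemma binary_support_sigma:
  assumes "binary_support N \<psi>"
  shows "binary_support N (sigma_plus j \<psi>)" "binary_support N (sigma_minus j \<psi>)"
proof -
  have upd: "\<epsilon> i \<in> {0, 1}" if "\<psi> (\<epsilon>(j := c)) \<noteq> 0" "\<epsilon> j \<in> {0, 1}" "i \<in> {1..N}" for \<epsilon> i c
  proof (cases "i = j")
    case False
    have "(\<epsilon>(j := c)) i \<in> {0, 1}"
      using assms[unfolded binary_support_def, rule_format, of "\<epsilon>(j := c)" i] that by simp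
    then show ?thesis using False by simp
  qed (use that in simp)
  show "binary_support N (sigma_plus j \<psi>)"
    unfolding binary_support_def sigma_plus_def
    using upd[of _ 0] by (simp split: if_splits)
  show "binary_support N (sigma_minus j \<psi>)"
    unfolding binary_support_def sigma_minus_def
    using upd[of _ 1] by (simp split: if_splits)
qed

lemma binary_support_local_E:
  assumes "binary_support N \<psi>"
  shows "binary_support N (local_E q s N j \<psi>)"
proof -
  have smul: "binary_support N (smul c \<phi>)" if "binary_support N \<phi>" for c and \<phi> :: "'a vec"
    unfolding binary_support_def
  proof (intro allI impI)
    fix \<epsilon> assume "smul c \<phi> \<epsilon> \<noteq> 0"
    then have "\<phi> \<epsilon> \<noteq> 0" by (auto simp: smul_def)
    then show "\<forall>j\<in>{1..N}. \<epsilon> j \<in> {0, 1}" using that by (simp add: binary_support_def)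
  qed
  have add: "binary_support N (\<phi>1 + \<phi>2)" if "binary_support N \<phi>1" "binary_support N \<phi>2" for \<phi>1 \<phi>2 :: "'a vec"
    unfolding binary_support_def
  proof (intro allI impI)
    fix \<epsilon> assume "(\<phi>1 + \<phi>2) \<epsilon> \<noteq> 0"
    then have "\<phi>1 \<epsilon> \<noteq> 0 \<or> \<phi>2 \<epsilon> \<noteq> 0" by auto
    then show "\<forall>j\<in>{1..N}. \<epsilon> j \<in> {0, 1}" using that by (auto simp: binary_support_def)
  qed
  have "local_E q s N j \<psi> = smul (if j = N then q else 1) (sigma_minus j (sigma_plus (nxt N j) \<psi>))
      + smul (s j) (sigma_plus j (sigma_minus j \<psi>))"
    by (simp add: local_E_def fun_eq_iff)
  then show ?thesis
    using add smul binary_support_sigma assms by metis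
qed

lemma foldr_weighted_pibar:
  assumes "2 \<le> N" "set js \<subseteq> {1..N}" "binary_support N \<psi>"
  shows "foldr (\<lambda>j F. app (weighted_pibar N j) \<circ> F) js id \<psi>
    = foldr (\<lambda>j F. local_E qvar (\<lambda>j. [:t N j:]) N j \<circ> F) js id \<psi>
    \<and> binary_support N (foldr (\<lambda>j F. local_E qvar (\<lambda>j. [:t N j:]) N j \<circ> F) js id \<psi>)"
  using assms by (induction js) (simp_all add: weighted_pibar_eq_local_E binary_support_local_E)

lemma foldr_comp_Cons: "foldr (\<lambda>j F. h j \<circ> F) (j # js) id \<phi> = h j (foldr (\<lambda>j F. h j \<circ> F) js id \<phi>)"
  by simp

lemma smul_foldr:
  "smul [:prod_list (map c js):] (foldr (\<lambda>j F. app (a j) \<circ> F) js id \<psi>)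
    = foldr (\<lambda>j F. app (scalar [:c j:] * a j) \<circ> F) js id \<psi>"
proof (induction js)
  case (Cons j js)
  have "smul [:prod_list (map c (j # js)):] \<phi> = smul [:c j:] (smul [:prod_list (map c js):] \<phi>)" for \<phi>
    by (simp add: smul_smul mult.commute)
  moreover have scale: "smul [:c j:] (app (a j) \<phi>) = app (scalar [:c j:] * a j) \<phi>" for \<phi>
    by simp
  ultimately have "smul [:prod_list (map c (j # js)):] (foldr (\<lambda>j F. app (a j) \<circ> F) (j # js) id \<psi>)
      = smul [:c j:] (app (a j) (smul [:prod_list (map c js):] (foldr (\<lambda>j F. app (a j) \<circ> F) js id \<psi>)))"
    by (simp only: foldr_comp_Cons app_smul)
  also have "\<dots> = app (scalar [:c j:] * a j) (foldr (\<lambda>j F. app (scalar [:c j:] * a j) \<circ> F) js id \<psi>)"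
    using scale[of "foldr (\<lambda>j F. app (scalar [:c j:] * a j) \<circ> F) js id \<psi>"] unfolding Cons .
  finally show ?case by (simp only: foldr_comp_Cons)
qed (simp add: one_pCons[symmetric])

lemma weighted_comm:
  assumes "2 \<le> N" "i \<in> {1..N}" "j \<in> {1..N}" "i \<noteq> nxt N j" "j \<noteq> nxt N i"
  shows "app (weighted_pi N i) \<circ> app (weighted_pi N j) = app (weighted_pi N j) \<circ> app (weighted_pi N i)"
    "app (weighted_pibar N i) \<circ> app (weighted_pibar N j) = app (weighted_pibar N j) \<circ> app (weighted_pibar N i)"
proof -
  have *: "app (scalar c * a) \<circ> app (scalar d * b) = app (scalar d * b) \<circ> app (scalar c * a)"
    if "a * b = b * a" for a b :: "laurent poly linop" and c d
  proof -
    have "(scalar c * a) * (scalar d * b) = (scalar d * b) * (scalar c * a)"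
      using that by (intro commute_mult commute_mult[symmetric] scalar_central scalar_central[symmetric]) auto
    then show ?thesis by (simp flip: app_simps)
  qed
  note comm = pi_op_comm[OF assms]
  show "app (weighted_pi N i) \<circ> app (weighted_pi N j) = app (weighted_pi N j) \<circ> app (weighted_pi N i)"
    unfolding weighted_pi_def by (rule * [OF comm])
  have "(pi_op N i + 1) * (pi_op N j + 1) = (pi_op N j + 1) * (pi_op N i + 1)"
    using comm by (simp add: algebra_simps)
  then show "app (weighted_pibar N i) \<circ> app (weighted_pibar N j) = app (weighted_pibar N j) \<circ> app (weighted_pibar N i)"
    unfolding weighted_pibar_def by (rule *)
qed

text \<open>
  Composing with the operators on the right instead of the left reverses the order of the word.
\<close>

lemma foldr_rev_clockwise_cong:
  fixes g :: "nat \<Rightarrow> 'a \<Rightarrow> 'a"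
  assumes N: "2 \<le> N"
    and comm: "\<And>i j. \<lbrakk>i \<in> {1..N}; j \<in> {1..N}; i \<noteq> nxt N j; j \<noteq> nxt N i\<rbrakk> \<Longrightarrow> g i \<circ> g j = g j \<circ> g i"
    and cw: "clockwise N js" "clockwise N ks" "set js = set ks" "set js \<subseteq> {1..N}"
  shows "foldr (\<lambda>j f. g j \<circ> f) (rev js) id = foldr (\<lambda>j f. g j \<circ> f) (rev ks) id"
proof -
  let ?G = "\<lambda>j F. F \<circ> g j :: 'a \<Rightarrow> 'a"
  have last: "foldr (\<lambda>j f. g j \<circ> f) ls h = foldr (\<lambda>j f. g j \<circ> f) ls id \<circ> h" for ls h
    by (induction ls) (auto simp: fun_eq_iff)
  have "foldr (\<lambda>j f. g j \<circ> f) (rev ls) id = foldr (\<lambda>j f. ?G j \<circ> f) ls id id" for ls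
  proof (induction ls)
    case (Cons l ls)
    have "foldr (\<lambda>j f. g j \<circ> f) (rev (l # ls)) id = foldr (\<lambda>j f. g j \<circ> f) (rev ls) (g l)"
      by (simp only: rev.simps foldr_append foldr_Cons foldr_Nil comp_apply id_apply comp_id)
    also have "\<dots> = foldr (\<lambda>j f. ?G j \<circ> f) ls id id \<circ> g l"
      by (simp only: last[of "rev ls" "g l"] Cons)
    also have "\<dots> = foldr (\<lambda>j f. ?G j \<circ> f) (l # ls) id id"
      by (simp only: foldr_Cons comp_apply)
    finally show ?case .
  qed simp
  moreover have "?G i \<circ> ?G j = ?G j \<circ> ?G i"
    if "i \<in> {1..N}" "j \<in> {1..N}" "i \<noteq> nxt N j" "j \<noteq> nxt N i" for i j
    using comm[OF that] by (auto simp: fun_eq_iff)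
  then have "foldr (\<lambda>j f. ?G j \<circ> f) js id = foldr (\<lambda>j f. ?G j \<circ> f) ks id"
    by (rule foldr_clockwise_cong[OF N _ cw])
  ultimately show ?thesis by simp
qed

lemma reduced_word_letters:
  "w \<in> clockwise_elements N r \<union> anticlockwise_elements N r \<Longrightarrow> set (reduced_word N w) \<subseteq> {1..N}"
proof -
  assume "w \<in> clockwise_elements N r \<union> anticlockwise_elements N r"
  then obtain js where "is_reduced_word_of N js w"
    by (auto simp: clockwise_elements_def anticlockwise_elements_def)
  then have "is_reduced_word_of N (reduced_word N w) w"
    unfolding reduced_word_def by (rule someI)
  then show ?thesis
    by (simp add: is_reduced_word_of_def is_word_of_def)
qed

lemma V_subset_V_tilde: "V N n \<subseteq> V_tilde N n"
  by (auto simp: V_def V_tilde_def weight_space_def adjoin_q_def Lambda_def)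

lemma V_binary_support:
  assumes "\<psi> \<in> V N n"
  shows "binary_support N \<psi>"
  unfolding binary_support_def
proof (intro allI impI ballI)
  fix \<epsilon> j assume nz: "\<psi> \<epsilon> \<noteq> 0" and j: "j \<in> {1..N}"
  have "\<epsilon> \<in> configs N n"
    using assms nz unfolding V_def weight_space_def by blast
  then have \<epsilon>: "\<epsilon> \<in> {1..N} \<rightarrow>\<^sub>E {0, 1}"
    unfolding configs_def by blast
  show "\<epsilon> j \<in> {0, 1}"
    by (rule PiE_mem[OF \<epsilon> j])
qed

theorem proposition1p4:
  fixes N n :: nat
  assumes "0 < n" and "n < N"
  shows
    "(\<forall>i \<in> {1..N - 1}. \<forall>\<psi> \<in> V N n.
        E N i \<psi> = (\<Sum>w \<in> clockwise_elements N i. smul [:T_elt N w:] (rho_n N n (pibar_elt N w) \<psi>))) \<and>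
     (\<forall>j \<in> {1..N - 1}. \<forall>\<psi> \<in> V N n.
        H N j \<psi> = (\<Sum>w \<in> anticlockwise_elements N j. smul [:T_elt N w:] (rho_n N n (pi_elt N w) \<psi>)))"
proof (intro conjI ballI)
  have N: "2 \<le> N" using assms by simp
  fix r \<psi> assume r: "r \<in> {1..N - 1}" and \<psi>: "\<psi> \<in> V N n"
  have rN: "r < N" using r by auto
  have rho_n: "rho_n N n h \<psi> = rho N h \<psi>" for h
    using \<psi> V_subset_V_tilde by (auto simp: rho_n_def)
  let ?I = "{(m, S) \<in> gap_data N. N - m + card S = r}"
  show "E N r \<psi> = (\<Sum>w \<in> clockwise_elements N r. smul [:T_elt N w:] (rho_n N n (pibar_elt N w) \<psi>))"
  proof -
    let ?F = "\<lambda>js. foldr (\<lambda>j F. app (weighted_pibar N j) \<circ> F) js id \<psi>"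
    have "(\<Sum>w\<in>clockwise_elements N r. smul [:T_elt N w:] (rho_n N n (pibar_elt N w) \<psi>))
        = (\<Sum>w\<in>clockwise_elements N r. ?F (reduced_word N w))"
    proof (rule sum.cong[OF refl])
      fix w assume "w \<in> clockwise_elements N r"
      then have "rho N (pibar_elt N w) = foldr (\<lambda>j F. app (pi_op N j + 1) \<circ> F) (reduced_word N w) id"
        using rho_word_pibar[OF N reduced_word_letters[of w N r]] by (simp add: pibar_elt_def)
      then show "smul [:T_elt N w:] (rho_n N n (pibar_elt N w) \<psi>) = ?F (reduced_word N w)"
        unfolding rho_n T_elt_def weighted_pibar_def t_def by (simp only: smul_foldr)
    qed
    also have "\<dots> = (\<Sum>(m, S)\<in>?I. ?F (gap_word N m S))"
      by (rule sum_clockwise_elements[OF N rN])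
         (rule fun_cong[OF foldr_clockwise_cong[OF N weighted_comm(2)[OF N]]])
    also have "\<dots> = E N r \<psi>"
      unfolding E_coeff[OF N rN]
      using foldr_weighted_pibar[OF N gap_word_letters(2) V_binary_support[OF \<psi>]]
      by (intro sum.cong refl) (auto simp only: split: prod.splits)
    finally show ?thesis by (rule sym)
  qed
  show "H N r \<psi> = (\<Sum>w \<in> anticlockwise_elements N r. smul [:T_elt N w:] (rho_n N n (pi_elt N w) \<psi>))"
  proof -
    let ?F = "\<lambda>js. foldr (\<lambda>j F. app (weighted_pi N j) \<circ> F) js id \<psi>"
    have "(\<Sum>w\<in>anticlockwise_elements N r. smul [:T_elt N w:] (rho_n N n (pi_elt N w) \<psi>))
        = (\<Sum>w\<in>anticlockwise_elements N r. ?F (reduced_word N w))"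
    proof (rule sum.cong[OF refl])
      fix w assume "w \<in> anticlockwise_elements N r"
      then have "rho N (pi_elt N w) = foldr (\<lambda>j F. app (pi_op N j) \<circ> F) (reduced_word N w) id"
        using rho_word_pi[OF N reduced_word_letters[of w N r]] by (simp add: pi_elt_def)
      then show "smul [:T_elt N w:] (rho_n N n (pi_elt N w) \<psi>) = ?F (reduced_word N w)"
        unfolding rho_n T_elt_def weighted_pi_def t_def by (simp only: smul_foldr)
    qed
    also have "\<dots> = (\<Sum>(m, S)\<in>?I. ?F (rev (gap_word N m S)))"
      by (rule sum_anticlockwise_elements[OF N rN])
         (rule fun_cong[OF foldr_rev_clockwise_cong[OF N weighted_comm(1)[OF N]]])
    also have "\<dots> = H N r \<psi>"
      unfolding H_coeff[OF N rN] weighted_pi_eq_local_H[OF N] ..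
    finally show ?thesis by (rule sym)
  qed
qed

end
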